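(* Let $R$ be a relation on $X\times Y$ with $|X|>1$. Suppose $x\in X$ is uniquely identifiable via $R$. Let $Q$ be the relation modeling $\mathrm{Lk}(\Psi_R,\{x\})$. Then the following three conditions are equivalent: (a) $R$ preserves attribute privacy for $x$. (b) $\mathrm{Lk}(\Psi_R,\{x\})\simeq \mathbb{S}^{k-2}$, with $k=|Y_x|$. (c) $\Phi_Q=\partial(Y_x)$.
   Context: Everything is finite. A relation $R$ on $X\times Y$ ($X$ "individuals", $Y$ "attributes", finite sets) is a subset of $X\times Y$. For $x\in X$, $Y_x=\{y\in Y:(x,y)\in R\}$; for $y\in Y$, $X_y=\{x\in X:(x,y)\in R\}$. For $\sigma\subseteq X$, $\phi_R(\sigma)=\bigcap_{x\in\sigma}Y_x$ with $\phi_R(\emptyset)=Y$; for $\gamma\subseteq Y$, $\psi_R(\gamma)=\bigcap_{y\in\gamma}X_y$ with $\psi_R(\emptyset)=X$. When $X,Y$ are nonempty, the Dowker complexes are the simplicial complexes $\Phi_R=\{\gamma\subseteq Y:\exists x\in X\ \forall y\in\gamma\ (x,y)\in R\}$ and $\Psi_R=\{\sigma\subseteq X:\exists y\in Y\ \forall x\in\sigma\ (x,y)\in R\}$; both contain $\emptyset$ as a simplex. Individual $x$ is uniquely identifiable via $R$ if $\psi_R(Y_x)=\{x\}$. $R$ preserves attribute privacy for $x$ if $(\phi_R\circ\psi_R)(\gamma)=\gamma$ for all $\gamma\subseteq Y_x$. For a simplicial complex $\Sigma$ and set $\sigma$, $\mathrm{Lk}(\Sigma,\sigma)=\{\tau\in\Sigma:\tau\cap\sigma=\emptyset,\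 \tau\cup\sigma\in\Sigma\}$. The relation $Q$ modeling $\mathrm{Lk}(\Psi_R,\sigma)$ is the restriction of $R$ to $\overline X\times\gamma$, that is, $Q=R\cap(\overline X\times\gamma)$, where $\gamma=\phi_R(\sigma)$ and $\overline X=\bigcup_{y\in\gamma}(X_y\setminus\sigma)$ (here $\sigma=\{x\}$, $\gamma=Y_x$); its Dowker complexes, when $\overline X$ and $\gamma$ are nonempty, are $\Phi_Q=\{\eta\subseteq\gamma:\exists z\in\overline X\ \forall y\in\eta\ (z,y)\in Q\}$ and $\Psi_Q=\{\tau\subseteq\overline X:\exists y\in\gamma\ \forall z\in\tau\ (z,y)\in Q\}$, except that if $\overline X=\emptyset$ and $\gamma\ne\emptyset$ then $\Phi_Q=\Psi_Q=\{\emptyset\}$. For a nonempty finite set $V$, $\partial(V)$ is the simplicial complex of all proper subsets of $V$. $\simeq$ denotes homotopy equivalence. $\mathbb{S}^{-1}$ is the empty complex $\{\emptyset\}$ (representing the empty space); a complex is $\simeq\mathbb{S}^{-1}$ iff it equals $\{\emptyset\}$. The void complex (no simplices at all) is distinct from $\{\emptyset\}$ and not homotopy equivalent to any sphere. *)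

theory Defs
  imports "HOL-Analysis.Analysis"
begin

section \<open>Relations between individuals and attributes\<close>

definition attributes_of :: "'b set \<Rightarrow> ('a \<times> 'b) set \<Rightarrow> 'a \<Rightarrow> 'b set" where
  "attributes_of Y R x = {y \<in> Y. (x, y) \<in> R}"

definition individuals_of :: "'a set \<Rightarrow> ('a \<times> 'b) set \<Rightarrow> 'b \<Rightarrow> 'a set" where
  "individuals_of X R y = {x \<in> X. (x, y) \<in> R}"

text \<open>The leading intersection with the ambient set makes the value at the empty set
  the whole ambient set and changes nothing otherwise.\<close>

definition phi :: "'b set \<Rightarrow> ('a \<times> 'b) set \<Rightarrow> 'a set \<Rightarrow> 'b set" where
  "phi Y R \<sigma> = Y \<inter> (\<Inter>x\<in>\<sigma>. attributes_of Y R x)"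

definition psi :: "'a set \<Rightarrow> ('a \<times> 'b) set \<Rightarrow> 'b set \<Rightarrow> 'a set" where
  "psi X R \<gamma> = X \<inter> (\<Inter>y\<in>\<gamma>. individuals_of X R y)"

definition uniquely_identifiable ::
    "'a set \<Rightarrow> 'b set \<Rightarrow> ('a \<times> 'b) set \<Rightarrow> 'a \<Rightarrow> bool" where
  "uniquely_identifiable X Y R x \<longleftrightarrow> psi X R (attributes_of Y R x) = {x}"

definition preserves_attribute_privacy ::
    "'a set \<Rightarrow> 'b set \<Rightarrow> ('a \<times> 'b) set \<Rightarrow> 'a \<Rightarrow> bool" where
  "preserves_attribute_privacy X Y R x \<longleftrightarrow>
     (\<forall>\<gamma>. \<gamma> \<subseteq> attributes_of Y R x \<longrightarrow> (phi Y R \<circ> psi X R) \<gamma> = \<gamma>)"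

section \<open>Simplicial complexes\<close>

text \<open>A simplicial complex is represented by its set of simplices, among them the empty
  simplex: \<open>{{}}\<close> is the empty complex and \<open>{}\<close> is the void complex.

  In the definition of \<open>dowker_Phi\<close> the case distinction is the convention for relations
  with attributes but no individuals, for which the second branch would give the void
  complex. For \<open>dowker_Psi\<close> the formula already yields \<open>{{}}\<close> in that situation.\<close>

definition dowker_Phi :: "'a set \<Rightarrow> 'b set \<Rightarrow> ('a \<times> 'b) set \<Rightarrow> 'b set set" where
  "dowker_Phi X Y R =
     (if X = {} \<and> Y \<noteq> {} then {{}}
      else {\<gamma>. \<gamma> \<subseteq> Y \<and> (\<exists>x\<in>X. \<forall>y\<in>\<gamma>. (x, y) \<in> R)})"

definition dowker_Psi :: "'a set \<Rightarrow> 'b set \<Rightarrow> ('a \<times> 'b) set \<Rightarrow> 'a set set" where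
  "dowker_Psi X Y R = {\<sigma>. \<sigma> \<subseteq> X \<and> (\<exists>y\<in>Y. \<forall>x\<in>\<sigma>. (x, y) \<in> R)}"

definition link_complex :: "'v set set \<Rightarrow> 'v set \<Rightarrow> 'v set set" where
  "link_complex K \<sigma> = {\<tau> \<in> K. \<tau> \<inter> \<sigma> = {} \<and> \<tau> \<union> \<sigma> \<in> K}"

definition boundary_complex :: "'v set \<Rightarrow> 'v set set" where
  "boundary_complex V = {W. W \<subset> V}"

section \<open>The relation modeling a link\<close>

definition link_attributes :: "'b set \<Rightarrow> ('a \<times> 'b) set \<Rightarrow> 'a set \<Rightarrow> 'b set" where
  "link_attributes Y R \<sigma> = phi Y R \<sigma>"

definition link_individuals ::
    "'a set \<Rightarrow> 'b set \<Rightarrow> ('a \<times> 'b) set \<Rightarrow> 'a set \<Rightarrow> 'a set" where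
  "link_individuals X Y R \<sigma> = (\<Union>y\<in>link_attributes Y R \<sigma>. individuals_of X R y - \<sigma>)"

definition link_relation ::
    "'a set \<Rightarrow> 'b set \<Rightarrow> ('a \<times> 'b) set \<Rightarrow> 'a set \<Rightarrow> ('a \<times> 'b) set" where
  "link_relation X Y R \<sigma> = R \<inter> (link_individuals X Y R \<sigma> \<times> link_attributes Y R \<sigma>)"

section \<open>Homotopy type\<close>

text \<open>Points of the realization are given by barycentric coordinates, extended by zero off
  the vertex set. The product topology is the usual topology of the realization when the
  complex has finitely many simplices, each of them finite. Both \<open>{{}}\<close> and \<open>{}\<close> are
  realized by the empty space.\<close>

definition geometric_realization :: "'v set set \<Rightarrow> ('v \<Rightarrow> real) topology" where
  "geometric_realization K =
     subtopology (powertop_real UNIV)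
       {t. (\<forall>v. 0 \<le> t v) \<and> {v. t v \<noteq> 0} \<in> K \<and> (\<Sum>v | t v \<noteq> 0. t v) = 1}"

text \<open>The dimension is an integer so as to cover \<open>-1\<close>, where the sphere is the empty
  complex \<open>{{}}\<close>, as distinct from the void complex. There are no spheres of dimension
  less than \<open>-1\<close>.\<close>

definition homotopy_equivalent_to_sphere :: "'v set set \<Rightarrow> int \<Rightarrow> bool" where
  "homotopy_equivalent_to_sphere K d \<longleftrightarrow>
     (if d = -1 then K = {{}}
      else d \<ge> 0 \<and> geometric_realization K homotopy_equivalent_space nsphere (nat d))"

end

theory Submission
  imports Defs "HOL-Homology.Brouwer_Degree"
begin

text \<open>Dowker duality replaces the link by \<open>\<Phi>\<^sub>Q\<close>, which unique identifiability makes a subcomplex of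
  the boundary of the simplex on \<open>Y\<^sub>x\<close>. That boundary is a sphere of dimension \<open>n = k - 2\<close>. A proper
  subcomplex \<open>K\<close> of it misses a facet, so it lies in a contractible \<open>n\<close>-dimensional cone. A map
  \<open>f\<close> from \<open>K\<close> to the \<open>n\<close>-sphere is uniformly close to a Lipschitz map \<open>h\<close> defined on the whole
  cone; the image of \<open>h\<close> misses a point \<open>c\<close> near the origin of \<open>(n + 1)\<close>-space, so normalizing
  \<open>h - c\<close> shows that \<open>f\<close> is homotopic to a map that factors through the cone, hence to a constant.
  If \<open>K\<close> were homotopy equivalent to the \<open>n\<close>-sphere, the sphere would be contractible.
  Privacy fails exactly when some facet of the boundary is missing.\<close>

section \<open>Separation axioms for function spaces\<close>

lemma open_coordinate_vimage: "open A \<Longrightarrow> open ((\<lambda>h :: 'a \<Rightarrow> 'b::topological_space. h i) -` A)"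
  by (rule open_vimage) simp_all

instance "fun" :: (type, t0_space) t0_space
proof
  fix f g :: "'a \<Rightarrow> 'b"
  assume "f \<noteq> g"
  then obtain i where "f i \<noteq> g i" by blast
  then obtain U where "open U" "(f i \<in> U) \<noteq> (g i \<in> U)"
    using t0_space_class.t0_space by metis
  then show "\<exists>U. open U \<and> (f \<in> U) \<noteq> (g \<in> U)"
    using open_coordinate_vimage[of U i] by (intro exI[of _ "(\<lambda>h. h i) -` U"]) auto
qed

instance "fun" :: (type, t1_space) t1_space
proof
  fix f g :: "'a \<Rightarrow> 'b"
  assume "f \<noteq> g"
  then obtain i where "f i \<noteq> g i" by blast
  then obtain U where "open U" "f i \<in> U" "g i \<notin> U"
    using t1_space_class.t1_space by metis
  then show "\<exists>U. open U \<and> f \<in> U \<and> g \<notin> U"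
    using open_coordinate_vimage[of U i] by (intro exI[of _ "(\<lambda>h. h i) -` U"]) auto
qed

text \<open>Open sets separating the values at a coordinate where two functions differ pull back to
  sets separating the functions. The Stone-Weierstrass locale \<open>function_ring_on\<close> is
  stated for Hausdorff types, hence the instance.\<close>

instance "fun" :: (type, t2_space) t2_space
proof
  fix f g :: "'a \<Rightarrow> 'b"
  assume "f \<noteq> g"
  then obtain i where "f i \<noteq> g i" by blast
  then obtain U W where "open U" "open W" "f i \<in> U" "g i \<in> W" "U \<inter> W = {}"
    using hausdorff by metis
  then show "\<exists>U W. open U \<and> open W \<and> f \<in> U \<and> g \<in> W \<and> U \<inter> W = {}"
    using open_coordinate_vimage[of U i] open_coordinate_vimage[of W i]
    by (intro exI[of _ "(\<lambda>h. h i) -` U"] exI[of _ "(\<lambda>h. h i) -` W"]) auto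
qed

section \<open>Realizations and spheres as subsets of function types\<close>

definition realization :: "'v set set \<Rightarrow> ('v \<Rightarrow> real) set" where
  "realization K = {t. (\<forall>v. 0 \<le> t v) \<and> {v. t v \<noteq> 0} \<in> K \<and> (\<Sum>v | t v \<noteq> 0. t v) = 1}"

definition unit_sphere :: "nat \<Rightarrow> (nat \<Rightarrow> real) set" where
  "unit_sphere n = {x. (\<Sum>i\<le>n. (x i)\<^sup>2) = 1 \<and> (\<forall>i>n. x i = 0)}"

text \<open>Passes from abstract topologies to subsets of a type with its own topology, where
  \<open>continuous_on\<close> and \<open>compact\<close> are available.\<close>

lemma geometric_realization_eq: "geometric_realization K = top_of_set (realization K)"
  by (simp add: geometric_realization_def realization_def euclidean_product_topology)

lemma nsphere_eq: "nsphere n = top_of_set (unit_sphere n)"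
  by (simp add: nsphere unit_sphere_def euclidean_product_topology)

lemma continuous_on_coordinate [continuous_intros]:
  "continuous_on S (\<lambda>x. x i :: 'b::topological_space)"
  by (rule continuous_on_subset[OF continuous_on_product_coordinates]) simp

text \<open>The added terms vanish. Summing over the fixed set \<open>V\<close> instead of the
  support makes the mass condition linear in \<open>t\<close>.\<close>

lemma realization_iff:
  assumes "finite V" "K \<subseteq> Pow V"
  shows "t \<in> realization K \<longleftrightarrow> (\<forall>v. 0 \<le> t v) \<and> {v. t v \<noteq> 0} \<in> K \<and> sum t V = 1"
proof -
  have "(\<Sum>v | t v \<noteq> 0. t v) = sum t V" if "{v. t v \<noteq> 0} \<in> K"
    using that assms by (intro sum.mono_neutral_left) auto
  then show ?thesis
    unfolding realization_def by auto
qed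

text \<open>The support of a convex combination lies in the union of the two supports, hence in the
  common simplex \<open>\<sigma>\<close>.\<close>

lemma realization_segment:
  assumes "finite V" "K \<subseteq> Pow V" and down: "\<And>\<sigma> \<tau>. \<sigma> \<in> K \<Longrightarrow> \<tau> \<subseteq> \<sigma> \<Longrightarrow> \<tau> \<in> K"
    and s: "s \<in> realization K" and t: "t \<in> realization K" and u: "u \<in> {0..1}"
    and \<sigma>: "\<sigma> \<in> K" "{v. s v \<noteq> 0} \<subseteq> \<sigma>" "{v. t v \<noteq> 0} \<subseteq> \<sigma>"
  shows "(\<lambda>v. (1 - u) * s v + u * t v) \<in> realization K"
proof -
  note iff = realization_iff[OF assms(1,2)]
  have "{v. (1 - u) * s v + u * t v \<noteq> 0} \<subseteq> {v. s v \<noteq> 0} \<union> {v. t v \<noteq> 0}"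
    by auto
  then have "{v. (1 - u) * s v + u * t v \<noteq> 0} \<in> K"
    using \<sigma> down by blast
  moreover have "(\<Sum>v\<in>V. (1 - u) * s v + u * t v) = (1 - u) * sum s V + u * sum t V"
    by (simp add: sum.distrib sum_distrib_left)
  ultimately show ?thesis
    using s t u by (simp add: iff)
qed

lemma homotopic_with_canonI:
  fixes H :: "real \<times> 'a::topological_space \<Rightarrow> 'b::topological_space"
  assumes "continuous_on ({0..1} \<times> S) H"
    and "\<And>u t. u \<in> {0..1} \<Longrightarrow> t \<in> S \<Longrightarrow> H (u, t) \<in> T"
    and "\<And>t. t \<in> S \<Longrightarrow> H (0, t) = f t" "\<And>t. t \<in> S \<Longrightarrow> H (1, t) = g t"
  shows "homotopic_with_canon (\<lambda>_. True) S T f g"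
  using assms by (subst homotopic_with) (auto intro!: exI[of _ H])

lemma homotopic_with_canon_segment:
  fixes f g :: "'a::topological_space \<Rightarrow> 'v \<Rightarrow> real"
  assumes "continuous_on S f" "continuous_on S g"
    and "\<And>x u. x \<in> S \<Longrightarrow> u \<in> {0..1} \<Longrightarrow> (\<lambda>v. (1 - u) * f x v + u * g x v) \<in> T"
  shows "homotopic_with_canon (\<lambda>_. True) S T f g"
proof -
  have "continuous_on ({0..1} \<times> S) (\<lambda>z. f (snd z) v)"
    "continuous_on ({0..1} \<times> S) (\<lambda>z. g (snd z) v)" for v :: 'v
    using assms(1,2)
    by (auto intro!: continuous_on_compose2[of S "\<lambda>x. f x v" _ snd]
        continuous_on_compose2[of S "\<lambda>x. g x v" _ snd] continuous_on_snd
        intro: continuous_on_product_then_coordinatewise continuous_on_id)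
  then have "continuous_on ({0..1} \<times> S) (\<lambda>z v. (1 - fst z) * f (snd z) v + fst z * g (snd z) v)"
    by (intro continuous_on_coordinatewise_then_product continuous_intros)
  then show ?thesis
    by (rule homotopic_with_canonI) (use assms(3) in auto)
qed

section \<open>Dowker duality\<close>

text \<open>The weight of \<open>y\<close> is positive when the simplex \<open>{z. (z, y) \<in> Q}\<close> carries almost all of the
  mass of \<open>s\<close>. The threshold is chosen so small that \<open>s\<close> and its image under the composite of the
  two maps lie in a common simplex and are joined by a segment.\<close>

definition dowker_weight :: "'a set \<Rightarrow> 'b set \<Rightarrow> ('a \<times> 'b) set \<Rightarrow> ('a \<Rightarrow> real) \<Rightarrow> 'b \<Rightarrow> real" where
  "dowker_weight A B Q s y =
     max 0 ((\<Sum>z | z \<in> A \<and> (z, y) \<in> Q. s z) - 1 + 1 / (card A + card B + 1))"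

definition dowker_map :: "'a set \<Rightarrow> 'b set \<Rightarrow> ('a \<times> 'b) set \<Rightarrow> ('a \<Rightarrow> real) \<Rightarrow> 'b \<Rightarrow> real" where
  "dowker_map A B Q s y =
     (if y \<in> B then dowker_weight A B Q s y / (\<Sum>y'\<in>B. dowker_weight A B Q s y') else 0)"

lemma dowker_Psi_subset: "dowker_Psi A B Q \<subseteq> Pow A"
  by (auto simp: dowker_Psi_def)

lemma dowker_Psi_mono: "\<sigma> \<in> dowker_Psi A B Q \<Longrightarrow> \<tau> \<subseteq> \<sigma> \<Longrightarrow> \<tau> \<in> dowker_Psi A B Q"
  unfolding dowker_Psi_def by blast

text \<open>For empty \<open>A\<close> one complex may be \<open>{{}}\<close> and the other void.
  Both are realized by the empty set, since an empty sum is not 1, so the comparison is made between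
  realizations.\<close>

lemma realization_dowker_Phi:
  "realization (dowker_Phi A B Q) = realization (dowker_Psi B A (Q\<inverse>))"
proof (cases "A = {}")
  case True
  then show ?thesis
    by (auto simp: dowker_Phi_def dowker_Psi_def realization_def)
next
  case False
  then show ?thesis
    by (simp add: dowker_Phi_def dowker_Psi_def)
qed

text \<open>Fixing one point \<open>s\<close> gives bounds on the weights that can be interpreted a
  second time with \<open>A\<close> and \<open>B\<close> exchanged and \<open>Q\<close>
  reversed.\<close>

locale dowker =
  fixes A :: "'a set" and B :: "'b set" and Q :: "('a \<times> 'b) set" and s :: "'a \<Rightarrow> real"
  assumes finA: "finite A" and finB: "finite B" and s: "s \<in> realization (dowker_Psi A B Q)"
begin

abbreviation "\<epsilon> \<equiv> 1 / (real (card A) + real (card B) + 1)"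
abbreviation "w \<equiv> dowker_weight A B Q s"

lemma s_props: "0 \<le> s v" "{v. s v \<noteq> 0} \<in> dowker_Psi A B Q" "sum s A = 1"
  using s realization_iff[OF finA dowker_Psi_subset] by auto

lemma sum_split: "(\<Sum>z | z \<in> A \<and> (z, y) \<in> Q. s z) = 1 - (\<Sum>z | z \<in> A \<and> (z, y) \<notin> Q. s z)"
proof -
  have "sum s A = sum s ({z. z \<in> A \<and> (z, y) \<in> Q} \<union> {z. z \<in> A \<and> (z, y) \<notin> Q})"
    by (rule arg_cong[of _ _ "sum s"]) auto
  also have "\<dots> = (\<Sum>z | z \<in> A \<and> (z, y) \<in> Q. s z) + (\<Sum>z | z \<in> A \<and> (z, y) \<notin> Q. s z)"
    by (rule sum.union_disjoint) (use finA in auto)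
  finally show ?thesis using s_props by simp
qed

lemma weight_bounds: "0 \<le> w y" "w y \<le> \<epsilon>"
proof -
  have "0 \<le> (\<Sum>z | z \<in> A \<and> (z, y) \<notin> Q. s z)"
    by (intro sum_nonneg s_props)
  then show "0 \<le> w y" "w y \<le> \<epsilon>"
    by (auto simp: dowker_weight_def sum_split algebra_simps)
qed

lemma weight_nonzero:
  assumes "w y \<noteq> 0"
  shows "(\<Sum>z | z \<in> A \<and> (z, y) \<notin> Q. s z) < \<epsilon>"
  using assms sum_split[of y] unfolding dowker_weight_def max_def
  by (simp only: of_nat_add of_nat_1 split: if_splits)

text \<open>An attribute witnessing that the support of \<open>s\<close> is a simplex misses no
  mass, so its weight attains the upper bound.\<close>

lemma carrier_simplex:
  obtains y where "y \<in> B" "\<And>z. s z \<noteq> 0 \<Longrightarrow> z \<in> A \<and> (z, y) \<in> Q" "w y = \<epsilon>"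
proof -
  obtain y where y: "y \<in> B" "\<And>z. s z \<noteq> 0 \<Longrightarrow> z \<in> A \<and> (z, y) \<in> Q"
    using s_props(2) by (auto simp: dowker_Psi_def)
  have "(\<Sum>z | z \<in> A \<and> (z, y) \<notin> Q. s z) = 0"
    by (rule sum.neutral) (use y in auto)
  then have "w y = \<epsilon>"
    by (simp add: dowker_weight_def sum_split)
  with y show ?thesis using that by blast
qed

text \<open>The carrier alone contributes \<open>\<epsilon>\<close>, so division by the total weight
  is legitimate. The upper bound follows from the bound on each weight.\<close>

lemma sum_weight: "\<epsilon> \<le> sum w B" "sum w B \<le> card B * \<epsilon>" "0 < sum w B"
proof -
  obtain y where "y \<in> B" "w y = \<epsilon>"
    using carrier_simplex by metis
  then show "\<epsilon> \<le> sum w B"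
    using member_le_sum[of y B w] weight_bounds(1) finB by auto
  then show "0 < sum w B"
    by (rule less_le_trans[rotated]) auto
  show "sum w B \<le> card B * \<epsilon>"
    using sum_bounded_above[of B w \<epsilon>] weight_bounds(2) by simp
qed

text \<open>The supports of points in the image are simplices because the complements of the sets
  \<open>{z. (z, y) \<in> Q}\<close>, for \<open>y\<close> in the support, have total weight less than one, so they do
  not cover \<open>A\<close>.\<close>

lemma dowker_map_in: "dowker_map A B Q s \<in> realization (dowker_Psi B A (Q\<inverse>))"
proof -
  let ?t = "dowker_map A B Q s"
  have "{y. ?t y \<noteq> 0} \<in> dowker_Psi B A (Q\<inverse>)"
  proof (rule ccontr)
    assume "\<not> ?thesis"
    moreover have "{y. ?t y \<noteq> 0} \<subseteq> B"
      by (auto simp: dowker_map_def)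
    ultimately have *: "\<forall>z\<in>A. \<exists>y. ?t y \<noteq> 0 \<and> (z, y) \<notin> Q" "{y. ?t y \<noteq> 0} \<subseteq> B"
      unfolding dowker_Psi_def by auto
    have "1 = sum s A" using s_props by simp
    also have "\<dots> \<le> (\<Sum>z\<in>A. \<Sum>y | y \<in> {y. ?t y \<noteq> 0} \<and> (z, y) \<notin> Q. s z)"
    proof (rule sum_mono)
      fix z assume "z \<in> A"
      with * obtain y where "?t y \<noteq> 0" "(z, y) \<notin> Q" by blast
      then show "s z \<le> (\<Sum>y | y \<in> {y. ?t y \<noteq> 0} \<and> (z, y) \<notin> Q. s z)"
        using finite_subset[OF *(2) finB] s_props(1)
        by (intro member_le_sum[of y _ "\<lambda>_. s z"]) auto
    qed
    also have "\<dots> = (\<Sum>y | ?t y \<noteq> 0. \<Sum>z | z \<in> A \<and> (z, y) \<notin> Q. s z)"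
      by (rule sum.swap_restrict) (use finite_subset[OF *(2) finB] finA in auto)
    also have "\<dots> \<le> card {y. ?t y \<noteq> 0} * \<epsilon>"
    proof (rule sum_bounded_above)
      fix y assume "y \<in> {y. ?t y \<noteq> 0}"
      then show "(\<Sum>z | z \<in> A \<and> (z, y) \<notin> Q. s z) \<le> \<epsilon>"
        by (intro less_imp_le weight_nonzero notI) (simp add: dowker_map_def split: if_splits)
    qed
    also have "\<dots> \<le> card B * \<epsilon>"
      using card_mono[OF finB *(2)] by (intro mult_right_mono) auto
    \<comment> \<open>The threshold \<open>\<epsilon>\<close> is symmetric in \<open>A\<close> and
      \<open>B\<close>, so this estimate also serves the map in the opposite direction.\<close>
    also have "\<dots> < 1"
      by (simp add: field_simps)
    finally show False by simp
  qed
  moreover have "0 \<le> ?t y" for y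
    using weight_bounds(1) sum_weight(3) by (simp add: dowker_map_def)
  moreover have "sum ?t B = 1"
    using sum_weight(3) by (simp add: dowker_map_def flip: sum_divide_distrib)
  ultimately show ?thesis
    using realization_iff[OF finB dowker_Psi_subset] by blast
qed

text \<open>The total weight is less than 1, so normalizing strictly increases the weight
  \<open>\<epsilon>\<close>.\<close>

lemma dowker_map_carrier_large:
  assumes "y \<in> B" "w y = \<epsilon>"
  shows "\<epsilon> < dowker_map A B Q s y"
proof -
  have "card B * \<epsilon> < 1"
    by (simp add: field_simps)
  then have "sum w B < 1"
    using sum_weight(2) by linarith
  then have "\<epsilon> * sum w B < \<epsilon> * 1"
    by (intro mult_strict_left_mono) auto
  then show ?thesis
    using assms sum_weight(3) by (simp add: dowker_map_def pos_less_divide_eq)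
qed

end

text \<open>The common simplex consists of all individuals related to a carrier \<open>y\<close> of
  \<open>s\<close>. If the round trip charged some \<open>z\<close> not related to \<open>y\<close>,
  the mass of the image of \<open>s\<close> missed by \<open>z\<close> would be below
  \<open>\<epsilon>\<close>, yet it includes the coordinate at \<open>y\<close>, which exceeds
  \<open>\<epsilon>\<close>.\<close>

lemma dowker_map_carrier:
  assumes finA: "finite A" and finB: "finite B" and s: "s \<in> realization (dowker_Psi A B Q)"
  obtains \<sigma> where "\<sigma> \<in> dowker_Psi A B Q" "{z. s z \<noteq> 0} \<subseteq> \<sigma>"
    "{z. dowker_map B A (Q\<inverse>) (dowker_map A B Q s) z \<noteq> 0} \<subseteq> \<sigma>"
proof -
  interpret d: dowker A B Q s using assms by unfold_locales
  define t where "t = dowker_map A B Q s"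
  interpret e: dowker B A "Q\<inverse>" t
    using assms d.dowker_map_in by unfold_locales (auto simp: t_def)
  obtain y where y: "y \<in> B" "\<And>z. s z \<noteq> 0 \<Longrightarrow> z \<in> A \<and> (z, y) \<in> Q" "d.w y = d.\<epsilon>"
    using d.carrier_simplex by blast
  have "z \<in> A \<and> (z, y) \<in> Q" if "dowker_map B A (Q\<inverse>) t z \<noteq> 0" for z
  proof (rule ccontr)
    assume *: "\<not> ?thesis"
    with that have "z \<in> A" "e.w z \<noteq> 0" by (auto simp: dowker_map_def split: if_splits)
    then have "(\<Sum>y | y \<in> B \<and> (y, z) \<notin> Q\<inverse>. t y) < d.\<epsilon>"
      using e.weight_nonzero[of z] by (simp only: add.commute[of "real (card B)"]) blast
    moreover have "t y \<le> (\<Sum>y | y \<in> B \<and> (y, z) \<notin> Q\<inverse>. t y)"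
      by (rule member_le_sum) (use y * \<open>z \<in> A\<close> finB e.s_props in auto)
    ultimately show False
      using d.dowker_map_carrier_large[OF y(1,3)] by (simp add: t_def)
  qed
  with y show ?thesis
    by (intro that[of "{z \<in> A. (z, y) \<in> Q}"]) (auto simp: dowker_Psi_def t_def)
qed

lemma dowker_map_in_realization:
  "finite A \<Longrightarrow> finite B \<Longrightarrow> s \<in> realization (dowker_Psi A B Q) \<Longrightarrow>
    dowker_map A B Q s \<in> realization (dowker_Psi B A (Q\<inverse>))"
  by (rule dowker.dowker_map_in) unfold_locales

lemma continuous_on_dowker_map:
  assumes "finite A" "finite B"
  shows "continuous_on (realization (dowker_Psi A B Q)) (dowker_map A B Q)"
proof (rule continuous_on_coordinatewise_then_product)
  fix y
  have w: "continuous_on S (\<lambda>s. dowker_weight A B Q s y)" for S y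
    unfolding dowker_weight_def by (intro continuous_intros)
  have "(\<Sum>y'\<in>B. dowker_weight A B Q s y') \<noteq> 0" if "s \<in> realization (dowker_Psi A B Q)" for s
    using dowker.sum_weight(3)[of A B Q s] assms that by (simp add: dowker_def)
  then show "continuous_on (realization (dowker_Psi A B Q)) (\<lambda>s. dowker_map A B Q s y)"
    unfolding dowker_map_def by (cases "y \<in> B") (auto intro!: continuous_intros w)
qed

lemma homotopic_dowker_map:
  assumes "finite A" "finite B"
  shows "homotopic_with_canon (\<lambda>_. True)
           (realization (dowker_Psi A B Q)) (realization (dowker_Psi A B Q))
           (dowker_map B A (Q\<inverse>) \<circ> dowker_map A B Q) id"
proof (rule homotopic_with_canon_segment)
  let ?P = "realization (dowker_Psi A B Q)" and ?P' = "realization (dowker_Psi B A (Q\<inverse>))"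
  have im: "dowker_map A B Q ` ?P \<subseteq> ?P'"
    using dowker_map_in_realization assms by blast
  show "continuous_on ?P (dowker_map B A (Q\<inverse>) \<circ> dowker_map A B Q)"
    by (rule continuous_on_compose[OF continuous_on_dowker_map
          continuous_on_subset[OF continuous_on_dowker_map im]]) (use assms in auto)
  show "continuous_on ?P id" by (rule continuous_on_id')
  fix s and u :: real assume s: "s \<in> ?P" and u: "u \<in> {0..1}"
  have t: "(dowker_map B A (Q\<inverse>) \<circ> dowker_map A B Q) s \<in> ?P"
    using dowker_map_in_realization[of B A "dowker_map A B Q s" "Q\<inverse>"] im s assms
    by auto
  obtain \<sigma> where "\<sigma> \<in> dowker_Psi A B Q" "{z. s z \<noteq> 0} \<subseteq> \<sigma>"
    "{z. dowker_map B A (Q\<inverse>) (dowker_map A B Q s) z \<noteq> 0} \<subseteq> \<sigma>"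
    using dowker_map_carrier[OF assms s] .
  then show "(\<lambda>v. (1 - u) * (dowker_map B A (Q\<inverse>) \<circ> dowker_map A B Q) s v + u * id s v) \<in> ?P"
    using realization_segment[OF assms(1) dowker_Psi_subset dowker_Psi_mono t s u] by auto
qed

text \<open>Both maps are one construction, applied to \<open>Q\<close> and to its converse, so a
  single homotopy lemma treats both composites.\<close>

theorem dowker_duality:
  assumes "finite A" "finite B"
  shows "geometric_realization (dowker_Psi A B Q) homotopy_equivalent_space
         geometric_realization (dowker_Phi A B Q)"
  unfolding homotopy_equivalent_space_def geometric_realization_eq realization_dowker_Phi
proof (intro exI conjI)
  let ?f = "dowker_map A B Q" and ?g = "dowker_map B A (Q\<inverse>)"
  show "continuous_map (top_of_set (realization (dowker_Psi A B Q)))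
          (top_of_set (realization (dowker_Psi B A (Q\<inverse>)))) ?f"
    using continuous_on_dowker_map[of A B Q] dowker_map_in_realization[of A B _ Q] assms by auto
  show "continuous_map (top_of_set (realization (dowker_Psi B A (Q\<inverse>))))
          (top_of_set (realization (dowker_Psi A B Q))) ?g"
    using continuous_on_dowker_map[of B A "Q\<inverse>"] dowker_map_in_realization[of B A _ "Q\<inverse>"] assms
    by auto
  show "homotopic_with_canon (\<lambda>_. True) (realization (dowker_Psi A B Q))
          (realization (dowker_Psi A B Q)) (?g \<circ> ?f) id"
    by (rule homotopic_dowker_map[OF assms])
  show "homotopic_with_canon (\<lambda>_. True) (realization (dowker_Psi B A (Q\<inverse>)))
          (realization (dowker_Psi B A (Q\<inverse>))) (?f \<circ> ?g) id"
    using homotopic_dowker_map[OF assms(2,1), of "Q\<inverse>"] unfolding converse_converse .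
qed

section \<open>The boundary of a simplex is a sphere\<close>

text \<open>Radial projection of (n + 1)-space minus the origin onto its unit sphere, with vectors
  stored as sequences.\<close>

definition normalize_upto :: "nat \<Rightarrow> (nat \<Rightarrow> real) \<Rightarrow> nat \<Rightarrow> real" where
  "normalize_upto n x i = x i / sqrt (\<Sum>j\<le>n. (x j)\<^sup>2)"

lemma normalize_upto_in:
  assumes "(\<Sum>j\<le>n. (x j)\<^sup>2) \<noteq> 0" "\<And>i. n < i \<Longrightarrow> x i = 0"
  shows "normalize_upto n x \<in> unit_sphere n"
proof -
  have "0 \<le> (\<Sum>j\<le>n. (x j)\<^sup>2)"
    by (intro sum_nonneg) auto
  then have "(\<Sum>i\<le>n. (x i / sqrt (\<Sum>j\<le>n. (x j)\<^sup>2))\<^sup>2) = 1"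
    using assms(1) by (simp add: power_divide flip: sum_divide_distrib)
  then show ?thesis
    using assms(2) by (simp add: unit_sphere_def normalize_upto_def)
qed

lemma normalize_upto_scale:
  assumes "x \<in> unit_sphere n" "0 < c"
  shows "normalize_upto n (\<lambda>i. x i / c) = x"
  using assms
  by (simp add: normalize_upto_def unit_sphere_def power_divide real_sqrt_divide fun_eq_iff
      flip: sum_divide_distrib)

lemma continuous_on_normalize_upto:
  fixes f :: "'a::topological_space \<Rightarrow> nat \<Rightarrow> real"
  assumes "continuous_on S f" "\<And>x. x \<in> S \<Longrightarrow> (\<Sum>j\<le>n. (f x j)\<^sup>2) \<noteq> 0"
  shows "continuous_on S (\<lambda>x. normalize_upto n (f x))"
proof (rule continuous_on_coordinatewise_then_product)
  show "continuous_on S (\<lambda>x. normalize_upto n (f x) i)" for i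
    unfolding normalize_upto_def
    by (intro continuous_on_divide continuous_on_real_sqrt continuous_on_sum continuous_on_power
        continuous_on_product_then_coordinatewise[OF assms(1)]) (use assms(2) in auto)
qed

lemma continuous_on_Min_image:
  fixes f :: "'i \<Rightarrow> 'a::topological_space \<Rightarrow> real"
  assumes "finite I" "I \<noteq> {}" "\<And>i. i \<in> I \<Longrightarrow> continuous_on S (f i)"
  shows "continuous_on S (\<lambda>x. Min ((\<lambda>i. f i x) ` I))"
  using assms
proof (induction I rule: finite_ne_induct)
  case (insert i I)
  then have "(\<lambda>x. Min ((\<lambda>i. f i x) ` insert i I)) = (\<lambda>x. min (f i x) (Min ((\<lambda>i. f i x) ` I)))"
    by (auto simp: Min_insert)
  with insert show ?case
    by (auto intro!: continuous_on_min)
qed simp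

lemma realization_boundary_iff:
  assumes "finite V"
  shows "t \<in> realization (boundary_complex V) \<longleftrightarrow>
    (\<forall>v. 0 \<le> t v) \<and> (\<forall>v. v \<notin> V \<longrightarrow> t v = 0) \<and> (\<exists>v\<in>V. t v = 0) \<and> sum t V = 1"
proof -
  have "boundary_complex V \<subseteq> Pow V"
    by (auto simp: boundary_complex_def)
  moreover have "{v. t v \<noteq> 0} \<in> boundary_complex V \<longleftrightarrow>
      (\<forall>v. v \<notin> V \<longrightarrow> t v = 0) \<and> (\<exists>v\<in>V. t v = 0)"
    unfolding boundary_complex_def by blast
  ultimately show ?thesis
    using realization_iff[OF assms, of "boundary_complex V" t] by blast
qed

context
  fixes V :: "'v set" and n :: nat and e :: "nat \<Rightarrow> 'v"
  assumes e: "bij_betw e {..Suc n} V"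
begin

text \<open>Subtracting the last coordinate identifies the hyperplane of coordinate sum 1 with (n +
  1)-space and sends the barycenter to the origin. In these coordinates the map is radial projection
  from the barycenter.\<close>

definition boundary_to_sphere :: "('v \<Rightarrow> real) \<Rightarrow> nat \<Rightarrow> real" where
  "boundary_to_sphere t =
     normalize_upto n (\<lambda>i. if i \<le> n then t (e i) - t (e (Suc n)) else 0)"

text \<open>A point \<open>x\<close> of the unit sphere has \<open>x (Suc n) = 0\<close>, so the minimum runs over the
  coordinates and zero.\<close>

definition sphere_to_boundary :: "(nat \<Rightarrow> real) \<Rightarrow> 'v \<Rightarrow> real" where
  "sphere_to_boundary x v =
     (if v \<in> V then (x (the_inv_into {..Suc n} e v) - Min ((\<lambda>i. x i) ` {..Suc n})) /
        (\<Sum>i\<le>Suc n. x i - Min ((\<lambda>i. x i) ` {..Suc n})) else 0)"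

lemma finite_V: "finite V"
  using bij_betw_finite[OF e] by simp

lemma sum_V: "sum t V = (\<Sum>i\<le>Suc n. t (e i))"
  using sum.reindex_bij_betw[OF e] by metis

lemma inv_e: "i \<le> Suc n \<Longrightarrow> the_inv_into {..Suc n} e (e i) = i"
  using the_inv_into_f_f[OF bij_betw_imp_inj_on[OF e]] by simp

lemma e_in: "i \<le> Suc n \<Longrightarrow> e i \<in> V"
  using bij_betwE[OF e] by auto

lemma e_cases:
  assumes "v \<in> V" obtains i where "i \<le> Suc n" "v = e i"
  using assms bij_betw_imp_surj_on[OF e] by auto

text \<open>If all differences vanished, \<open>t\<close> would be constant on \<open>V\<close>.
  Some coordinate is 0, so \<open>t\<close> would vanish on \<open>V\<close>, against total mass
  1.\<close>

lemma boundary_to_sphere_nonzero: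
  assumes "t \<in> realization (boundary_complex V)"
  shows "(\<Sum>j\<le>n. (if j \<le> n then t (e j) - t (e (Suc n)) else 0)\<^sup>2) \<noteq> 0"
proof
  assume "(\<Sum>j\<le>n. (if j \<le> n then t (e j) - t (e (Suc n)) else 0)\<^sup>2) = 0"
  then have "\<forall>j\<in>{..n}. (if j \<le> n then t (e j) - t (e (Suc n)) else 0)\<^sup>2 = 0"
    by (subst (asm) sum_nonneg_eq_0_iff) auto
  then have "t (e j) = t (e (Suc n))" if "j \<le> Suc n" for j
    using that by (cases "j = Suc n") auto
  then have eq: "t v = t (e (Suc n))" if "v \<in> V" for v
    using e_cases[OF that] by blast
  obtain v where "v \<in> V" "t v = 0" "sum t V = 1"
    using assms realization_boundary_iff[OF finite_V] by blast
  then show False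
    using eq by (auto simp: sum.neutral)
qed

lemma boundary_to_sphere_in:
  "t \<in> realization (boundary_complex V) \<Longrightarrow> boundary_to_sphere t \<in> unit_sphere n"
  unfolding boundary_to_sphere_def
  using boundary_to_sphere_nonzero by (intro normalize_upto_in) auto

text \<open>If every coordinate equalled the minimum, all would equal the last one, which is 0, and
  \<open>x\<close> would not be a unit vector.\<close>

lemma sphere_sum_pos:
  assumes "x \<in> unit_sphere n"
  shows "0 < (\<Sum>i\<le>Suc n. x i - Min ((\<lambda>i. x i) ` {..Suc n}))"
proof -
  let ?m = "Min ((\<lambda>i. x i) ` {..Suc n})"
  have le: "?m \<le> x i" if "i \<le> Suc n" for i
    using that by (intro Min_le) auto
  have "\<exists>i\<le>Suc n. x i \<noteq> ?m"
  proof (rule ccontr)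
    assume "\<not> ?thesis"
    moreover have "x (Suc n) = 0"
      using assms by (simp add: unit_sphere_def)
    ultimately have "x i = 0" if "i \<le> n" for i
      using that by (metis le_SucI le_refl)
    then show False
      using assms by (simp add: unit_sphere_def)
  qed
  then obtain i where "i \<le> Suc n" "x i \<noteq> ?m" by blast
  then show ?thesis
    using le by (intro sum_pos2[of _ i]) (simp_all add: order_less_le)
qed

lemma sphere_to_boundary_in:
  assumes x: "x \<in> unit_sphere n"
  shows "sphere_to_boundary x \<in> realization (boundary_complex V)"
proof -
  let ?m = "Min ((\<lambda>i. x i) ` {..Suc n})"
  have le: "?m \<le> x i" if "i \<le> Suc n" for i
    using that by (intro Min_le) auto
  have eq: "sphere_to_boundary x (e i) = (x i - ?m) / (\<Sum>i\<le>Suc n. x i - ?m)" if "i \<le> Suc n" for i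
    using that by (simp add: sphere_to_boundary_def inv_e e_in)
  have "0 \<le> sphere_to_boundary x v" for v
  proof (cases "v \<in> V")
    case True
    then obtain i where "i \<le> Suc n" "v = e i" by (rule e_cases)
    then show ?thesis
      using eq[of i] le[of i] sphere_sum_pos[OF x] by (simp del: sum.atMost_Suc)
  qed (simp add: sphere_to_boundary_def)
  moreover have "sum (sphere_to_boundary x) V = 1"
    unfolding sum_V using sphere_sum_pos[OF x] eq
    by (simp add: sum_divide_distrib[symmetric] del: sum.atMost_Suc)
  moreover have "\<exists>v\<in>V. sphere_to_boundary x v = 0"
  proof -
    have "?m \<in> (\<lambda>i. x i) ` {..Suc n}"
      by (rule Min_in) auto
    then obtain i where "?m = x i" "i \<in> {..Suc n}" by (rule imageE)
    then show ?thesis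
      using eq[of i] e_in[of i] by auto
  qed
  ultimately show ?thesis
    by (simp add: realization_boundary_iff[OF finite_V] sphere_to_boundary_def)
qed

text \<open>Up to a shift and a positive scale factor, \<open>boundary_to_sphere t\<close> has the
  coordinates of \<open>t\<close>. Subtracting the minimum undoes the shift, and dividing by the sum
  undoes the scaling.\<close>

lemma sphere_to_boundary_inverse:
  assumes t: "t \<in> realization (boundary_complex V)"
  shows "sphere_to_boundary (boundary_to_sphere t) = t"
proof -
  have t': "\<And>v. 0 \<le> t v" "\<And>v. v \<notin> V \<Longrightarrow> t v = 0" "\<exists>v\<in>V. t v = 0" "sum t V = 1"
    using t realization_boundary_iff[OF finite_V] by blast+
  define c where "c = sqrt (\<Sum>j\<le>n. (if j \<le> n then t (e j) - t (e (Suc n)) else 0)\<^sup>2)"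
  have "0 \<le> (\<Sum>j\<le>n. (if j \<le> n then t (e j) - t (e (Suc n)) else 0)\<^sup>2)"
    by (rule sum_nonneg) simp
  then have c: "0 < c"
    using boundary_to_sphere_nonzero[OF t] unfolding c_def by (intro real_sqrt_gt_zero) linarith
  have x: "boundary_to_sphere t i = (t (e i) - t (e (Suc n))) / c" if "i \<le> Suc n" for i
    using that by (auto simp: boundary_to_sphere_def normalize_upto_def c_def le_Suc_eq)
  obtain j where j: "j \<le> Suc n" "t (e j) = 0"
    using t'(3) e_cases by metis
  \<comment> \<open>The least coordinate of \<open>t\<close> is 0, attained at \<open>e j\<close>.
    The term \<open>0 -\<close> keeps the shape of the other coordinates in
    \<open>x\<close>.\<close>
  have m: "Min ((\<lambda>i. boundary_to_sphere t i) ` {..Suc n}) = (0 - t (e (Suc n))) / c"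
  proof (rule Min_eqI)
    show "(0 - t (e (Suc n))) / c \<in> (\<lambda>i. boundary_to_sphere t i) ` {..Suc n}"
      using j x[of j] by force
    fix y assume "y \<in> (\<lambda>i. boundary_to_sphere t i) ` {..Suc n}"
    then obtain i where "i \<le> Suc n" "y = boundary_to_sphere t i" by auto
    then show "(0 - t (e (Suc n))) / c \<le> y"
      using x[of i] c t'(1)[of "e i"] divide_right_mono[of "0 - t (e (Suc n))" _ c] by simp
  qed auto
  have d: "boundary_to_sphere t i - (0 - t (e (Suc n))) / c = t (e i) / c" if "i \<le> Suc n" for i
    using x[OF that] by (simp add: diff_divide_distrib)
  have S: "(\<Sum>i\<le>Suc n. boundary_to_sphere t i - (0 - t (e (Suc n))) / c) = 1 / c"
    using d t'(4)[unfolded sum_V] by (simp add: sum_divide_distrib[symmetric] del: sum.atMost_Suc)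
  show ?thesis
  proof
    fix v
    show "sphere_to_boundary (boundary_to_sphere t) v = t v"
    proof (cases "v \<in> V")
      case True
      then obtain i where i: "i \<le> Suc n" "v = e i" by (rule e_cases)
      then show ?thesis
        unfolding sphere_to_boundary_def m S using d[of i] c inv_e[of i] True by simp
    qed (simp add: sphere_to_boundary_def t')
  qed
qed

text \<open>The minimum cancels in the differences, which leaves a positive multiple of
  \<open>x\<close>.\<close>

lemma boundary_to_sphere_inverse:
  assumes x: "x \<in> unit_sphere n"
  shows "boundary_to_sphere (sphere_to_boundary x) = x"
proof -
  define m where "m = Min ((\<lambda>i. x i) ` {..Suc n})"
  define S where "S = (\<Sum>i\<le>Suc n. x i - m)"
  have "x i = 0" if "n < i" for i
    using x that by (simp add: unit_sphere_def)
  then have "(if i \<le> n then sphere_to_boundary x (e i) - sphere_to_boundary x (e (Suc n)) else 0)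
      = x i / S" for i
    unfolding sphere_to_boundary_def m_def[symmetric] S_def[symmetric]
    by (simp add: inv_e e_in diff_divide_distrib)
  then show ?thesis
    unfolding boundary_to_sphere_def using normalize_upto_scale[OF x, of S] sphere_sum_pos[OF x] by (simp add: S_def m_def)
qed

lemma continuous_on_boundary_to_sphere:
  "continuous_on (realization (boundary_complex V)) boundary_to_sphere"
  unfolding boundary_to_sphere_def
proof (rule continuous_on_normalize_upto)
  show "continuous_on (realization (boundary_complex V))
          (\<lambda>t i. if i \<le> n then t (e i) - t (e (Suc n)) else 0)"
  proof (rule continuous_on_coordinatewise_then_product)
    show "continuous_on (realization (boundary_complex V))
            (\<lambda>t. if i \<le> n then t (e i) - t (e (Suc n)) else 0)" for i
      by (cases "i \<le> n") (auto intro!: continuous_on_diff continuous_on_coordinate)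
  qed
qed (rule boundary_to_sphere_nonzero)

lemma continuous_on_sphere_to_boundary:
  "continuous_on (unit_sphere n) sphere_to_boundary"
proof (rule continuous_on_coordinatewise_then_product)
  fix v
  have m: "continuous_on (unit_sphere n) (\<lambda>x. Min ((\<lambda>i. x i) ` {..Suc n}))"
    by (rule continuous_on_Min_image) (auto intro: continuous_on_coordinate)
  have "continuous_on (unit_sphere n)
     (\<lambda>x. (x (the_inv_into {..Suc n} e v) - Min ((\<lambda>i. x i) ` {..Suc n})) /
        (\<Sum>i\<le>Suc n. x i - Min ((\<lambda>i. x i) ` {..Suc n})))"
    using sphere_sum_pos
    by (intro continuous_on_divide continuous_on_diff continuous_on_sum m continuous_on_coordinate)
       (force simp del: sum.atMost_Suc)
  then show "continuous_on (unit_sphere n) (\<lambda>x. sphere_to_boundary x v)"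
    unfolding sphere_to_boundary_def by (cases "v \<in> V") simp_all
qed

lemma homeomorphic_boundary_nsphere_enumerated:
  "geometric_realization (boundary_complex V) homeomorphic_space nsphere n"
  unfolding homeomorphic_space_def homeomorphic_maps_def geometric_realization_eq nsphere_eq
  using continuous_on_boundary_to_sphere continuous_on_sphere_to_boundary
    boundary_to_sphere_in sphere_to_boundary_in
    boundary_to_sphere_inverse sphere_to_boundary_inverse
  by (intro exI[of _ boundary_to_sphere] exI[of _ sphere_to_boundary]) auto

end

theorem homeomorphic_boundary_nsphere:
  assumes "finite V" "card V = n + 2"
  shows "geometric_realization (boundary_complex V) homeomorphic_space nsphere n"
proof -
  obtain e where "bij_betw e {0..<card V} V"
    using ex_bij_betw_nat_finite[OF assms(1)] by blast
  then have "bij_betw e {..Suc n} V"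
    using assms(2) by (simp add: atLeast0LessThan lessThan_Suc_atMost)
  then show ?thesis
    by (rule homeomorphic_boundary_nsphere_enumerated)
qed

section \<open>Proper subcomplexes of the boundary of a simplex\<close>

text \<open>The realization is a finite union of closed faces, each a product of compact sets cut by
  a closed hyperplane. Points of a closed face may have smaller support, which is where closure
  under subsets enters.\<close>

lemma compact_realization:
  assumes "finite V" "K \<subseteq> Pow V" and down: "\<And>\<sigma> \<tau>. \<sigma> \<in> K \<Longrightarrow> \<tau> \<subseteq> \<sigma> \<Longrightarrow> \<tau> \<in> K"
  shows "compact (realization K)"
proof -
  define F where "F \<sigma> = (PiE UNIV (\<lambda>v. if v \<in> \<sigma> then {0..1::real} else {0})) \<inter> {t. sum t \<sigma> = 1}"
    for \<sigma> :: "'a set"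
  have "compact (F \<sigma>)" for \<sigma>
    unfolding F_def
  proof (rule compact_Int_closed)
    have "compactin (product_topology (\<lambda>_. euclidean) UNIV)
        (PiE UNIV (\<lambda>v. if v \<in> \<sigma> then {0..1::real} else {0}))"
      unfolding compactin_PiE by (auto simp: compactin_euclidean_iff)
    then show "compact (PiE UNIV (\<lambda>v. if v \<in> \<sigma> then {0..1::real} else {0}))"
      by (simp add: euclidean_product_topology compactin_euclidean_iff)
    show "closed {t::'a \<Rightarrow> real. sum t \<sigma> = 1}"
      by (intro closed_Collect_eq continuous_intros)
  qed
  moreover have "realization K = (\<Union>\<sigma>\<in>K. F \<sigma>)"
  proof (intro equalityI subsetI)
    fix t assume "t \<in> realization K"
    then have t: "\<And>v. 0 \<le> t v" "{v. t v \<noteq> 0} \<in> K" "(\<Sum>v | t v \<noteq> 0. t v) = 1"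
      by (auto simp: realization_def)
    have "finite {v. t v \<noteq> 0}"
      using t(2) assms(1,2) finite_subset by blast
    then have "t v \<le> 1" if "t v \<noteq> 0" for v
      using member_le_sum[of v "{v. t v \<noteq> 0}" t] t that by simp
    then have "t \<in> F {v. t v \<noteq> 0}"
      using t by (auto simp: F_def)
    then show "t \<in> (\<Union>\<sigma>\<in>K. F \<sigma>)"
      using t(2) by blast
  next
    fix t assume "t \<in> (\<Union>\<sigma>\<in>K. F \<sigma>)"
    then obtain \<sigma> where \<sigma>: "\<sigma> \<in> K" "t \<in> F \<sigma>" by blast
    then have t: "t v \<in> (if v \<in> \<sigma> then {0..1} else {0})" "sum t \<sigma> = 1" for v
      unfolding F_def using PiE_mem[of t UNIV _ v] by blast+
    have "0 \<le> t v" "v \<notin> \<sigma> \<Longrightarrow> t v = 0" for v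
      using t(1)[of v] by (auto split: if_splits)
    then have *: "{v. t v \<noteq> 0} \<subseteq> \<sigma>" "\<And>v. 0 \<le> t v"
      by auto
    moreover have "finite \<sigma>"
      using \<sigma>(1) assms(1,2) finite_subset by blast
    then have "(\<Sum>v | t v \<noteq> 0. t v) = sum t \<sigma>"
      using * by (intro sum.mono_neutral_left) auto
    ultimately show "t \<in> realization K"
      using down[OF \<sigma>(1)] t(2) by (simp add: realization_def)
  qed
  moreover have "finite K"
    using assms(1,2) finite_subset by blast
  ultimately show ?thesis by auto
qed

section \<open>Lipschitz approximation of continuous functions\<close>

definition unit_box :: "'v set \<Rightarrow> ('v \<Rightarrow> real) set" where
  "unit_box V = {t. \<forall>v\<in>V. t v \<in> {0..1}}"

definition l1_dist :: "'v set \<Rightarrow> ('v \<Rightarrow> real) \<Rightarrow> ('v \<Rightarrow> real) \<Rightarrow> real" where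
  "l1_dist V s t = (\<Sum>v\<in>V. \<bar>s v - t v\<bar>)"

lemma l1_dist_nonneg: "0 \<le> l1_dist V s t"
  by (simp add: l1_dist_def sum_nonneg)

text \<open>The bound \<open>M\<close> makes the class closed under products. Both bounds are asked
  for only on \<open>unit_box V\<close>, because coordinate functions are unbounded on the whole
  type.\<close>

definition lipschitz_maps :: "'v set \<Rightarrow> (('v \<Rightarrow> real) \<Rightarrow> real) set" where
  "lipschitz_maps V = {h. continuous_on UNIV h \<and>
     (\<exists>L M. 0 \<le> L \<and> 0 \<le> M \<and> (\<forall>s\<in>unit_box V. \<bar>h s\<bar> \<le> M) \<and>
       (\<forall>s\<in>unit_box V. \<forall>t\<in>unit_box V. \<bar>h s - h t\<bar> \<le> L * l1_dist V s t))}"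

lemma lipschitz_mapsI:
  assumes "continuous_on UNIV h" "0 \<le> L" "0 \<le> M" "\<And>s. s \<in> unit_box V \<Longrightarrow> \<bar>h s\<bar> \<le> M"
    "\<And>s t. s \<in> unit_box V \<Longrightarrow> t \<in> unit_box V \<Longrightarrow> \<bar>h s - h t\<bar> \<le> L * l1_dist V s t"
  shows "h \<in> lipschitz_maps V"
  using assms unfolding lipschitz_maps_def by blast

text \<open>Stone-Weierstrass for the algebra of Lipschitz functions: coordinates from
  \<open>V\<close> separate the points of \<open>S\<close>, because these vanish off
  \<open>V\<close>.\<close>

lemma lipschitz_approximation:
  fixes f :: "('v \<Rightarrow> real) \<Rightarrow> real"
  assumes V: "finite V" and S: "compact S" "S \<subseteq> unit_box V"
    and zero: "\<And>t v. t \<in> S \<Longrightarrow> v \<notin> V \<Longrightarrow> t v = 0"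
    and f: "continuous_on S f" and "0 < \<epsilon>"
  obtains h where "h \<in> lipschitz_maps V" "\<And>t. t \<in> S \<Longrightarrow> \<bar>f t - h t\<bar> < \<epsilon>"
proof -
  interpret function_ring_on "lipschitz_maps V" S
  proof
    show "compact S" by fact
    show "continuous_on S g" if "g \<in> lipschitz_maps V" for g
      using that continuous_on_subset[of UNIV g S] by (auto simp: lipschitz_maps_def)
    show "(\<lambda>_. c) \<in> lipschitz_maps V" for c
      by (rule lipschitz_mapsI[of _ 0 "\<bar>c\<bar>"]) (auto simp: l1_dist_nonneg)
  next
    fix g k assume "g \<in> lipschitz_maps V" "k \<in> lipschitz_maps V"
    then obtain L M L' M' where g: "continuous_on UNIV g" "0 \<le> L" "0 \<le> M"
        "\<And>s. s \<in> unit_box V \<Longrightarrow> \<bar>g s\<bar> \<le> M"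
        "\<And>s t. s \<in> unit_box V \<Longrightarrow> t \<in> unit_box V \<Longrightarrow> \<bar>g s - g t\<bar> \<le> L * l1_dist V s t"
      and k: "continuous_on UNIV k" "0 \<le> L'" "0 \<le> M'"
        "\<And>s. s \<in> unit_box V \<Longrightarrow> \<bar>k s\<bar> \<le> M'"
        "\<And>s t. s \<in> unit_box V \<Longrightarrow> t \<in> unit_box V \<Longrightarrow> \<bar>k s - k t\<bar> \<le> L' * l1_dist V s t"
      by (auto simp: lipschitz_maps_def)
    show "(\<lambda>t. g t + k t) \<in> lipschitz_maps V"
    proof (rule lipschitz_mapsI[of _ "L + L'" "M + M'"])
      show "continuous_on UNIV (\<lambda>t. g t + k t)"
        using g(1) k(1) by (rule continuous_on_add)
      show "\<bar>g s + k s\<bar> \<le> M + M'" if "s \<in> unit_box V" for s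
        using g(4)[OF that] k(4)[OF that] by linarith
      show "\<bar>(g s + k s) - (g t + k t)\<bar> \<le> (L + L') * l1_dist V s t"
        if "s \<in> unit_box V" "t \<in> unit_box V" for s t
        using g(5)[OF that] k(5)[OF that] unfolding distrib_right by linarith
    qed (use g k in auto)
    show "(\<lambda>t. g t * k t) \<in> lipschitz_maps V"
    proof (rule lipschitz_mapsI[of _ "M * L' + L * M'" "M * M'"])
      show "continuous_on UNIV (\<lambda>t. g t * k t)"
        using g(1) k(1) by (rule continuous_on_mult)
      show "\<bar>g s * k s\<bar> \<le> M * M'" if "s \<in> unit_box V" for s
        using g(3) g(4)[OF that] k(4)[OF that] by (simp add: abs_mult mult_mono)
      show "\<bar>g s * k s - g t * k t\<bar> \<le> (M * L' + L * M') * l1_dist V s t"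
        if st: "s \<in> unit_box V" "t \<in> unit_box V" for s t
      proof -
        have "\<bar>g s * k s - g t * k t\<bar> = \<bar>g s * (k s - k t) + (g s - g t) * k t\<bar>"
          by (simp add: algebra_simps)
        also have "\<dots> \<le> \<bar>g s\<bar> * \<bar>k s - k t\<bar> + \<bar>g s - g t\<bar> * \<bar>k t\<bar>"
          by (simp add: abs_mult[symmetric] abs_triangle_ineq)
        also have "\<dots> \<le> M * (L' * l1_dist V s t) + (L * l1_dist V s t) * M'"
          using g(3) g(4)[OF st(1)] g(5)[OF st] k(4)[OF st(2)] k(5)[OF st] g(2)
          by (intro add_mono mult_mono) (auto simp: l1_dist_nonneg)
        finally show ?thesis by (simp add: algebra_simps)
      qed
    qed (use g k in auto)
  next
    fix s t assume st: "s \<in> S" "t \<in> S" "s \<noteq> t"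
    then obtain v where "s v \<noteq> t v" by blast
    moreover from this have "v \<in> V" using zero st by metis
    moreover from this have "(\<lambda>t. t v) \<in> lipschitz_maps V"
    proof (intro lipschitz_mapsI[of _ 1 1])
      show "continuous_on UNIV (\<lambda>t::'v \<Rightarrow> real. t v)"
        by (rule continuous_on_coordinate)
      show "\<bar>s v - t v\<bar> \<le> 1 * l1_dist V s t" for s t
        unfolding l1_dist_def using V \<open>v \<in> V\<close> by (simp add: member_le_sum[of v V "\<lambda>v. \<bar>s v - t v\<bar>"])
    qed (auto simp: unit_box_def)
    ultimately show "\<exists>f\<in>lipschitz_maps V. f s \<noteq> f t"
      by (intro bexI[of _ "\<lambda>t. t v"])
  qed
  show ?thesis
    using Stone_Weierstrass_basic[OF f \<open>0 < \<epsilon>\<close>] that by blast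
qed

text \<open>The image of an \<open>n\<close>-dimensional set under a Lipschitz map cannot contain all points of
  a cubical grid in dimension \<open>n + 1\<close>, for lack of cells.\<close>

lemma grid_point_not_attained:
  fixes h :: "nat \<Rightarrow> 'p \<Rightarrow> real" and cell :: "nat \<Rightarrow> 'p \<Rightarrow> 'q"
  assumes fin: "\<And>M. 0 < M \<Longrightarrow> finite (cell M ` D)"
    and card: "\<And>M. 0 < M \<Longrightarrow> card (cell M ` D) \<le> a * (M + 1) ^ n"
    and diam: "\<And>M p q i. 0 < M \<Longrightarrow> p \<in> D \<Longrightarrow> q \<in> D \<Longrightarrow> cell M p = cell M q \<Longrightarrow> i \<le> n \<Longrightarrow>
      \<bar>h i p - h i q\<bar> \<le> b / real M"
    and "0 < \<eta>"
  shows "\<exists>c. (\<forall>i\<le>n. \<bar>c i\<bar> \<le> \<eta>) \<and> (\<forall>p\<in>D. \<exists>i\<le>n. h i p \<noteq> c i)"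
proof (rule ccontr)
  assume "\<not> ?thesis"
  then have hit: "\<exists>p\<in>D. \<forall>i\<le>n. h i p = c i" if "\<forall>i\<le>n. \<bar>c i\<bar> \<le> \<eta>" for c
    using that by blast
  \<comment> \<open>With \<open>M = q * N\<close>, the variation \<open>b / M\<close> on a cell is
    less than the grid spacing \<open>\<eta> / N\<close>. The maximum with 0 makes \<open>q\<close>
    positive.\<close>
  obtain q :: nat where q: "max (b / \<eta>) 0 < real q"
    using reals_Archimedean2 by blast
  \<comment> \<open>There are \<open>N ^ (n + 1)\<close> grid points and at most
    \<open>a * (q + 1) ^ n * N ^ n\<close> cells, so \<open>N\<close> is taken just above the
    constant factor.\<close>
  define N where "N = a * (q + 1) ^ n + 1"
  define M where "M = q * N"
  define J where "J = PiE {..n} (\<lambda>_. {..<N})"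
  have "0 < q" "0 < N"
    using q by (auto simp: N_def)
  then have "0 < M" by (simp add: M_def)
  have "\<exists>p\<in>D. \<forall>i\<le>n. h i p = \<eta> * real (j i) / real N" if "j \<in> J" for j
  proof (rule hit, intro allI impI)
    fix i assume "i \<le> n"
    then have "j i < N" using that by (auto simp: J_def)
    then show "\<bar>\<eta> * real (j i) / real N\<bar> \<le> \<eta>"
      using \<open>0 < \<eta>\<close> by (simp add: abs_mult pos_divide_le_eq)
  qed
  then obtain p where p: "\<And>j. j \<in> J \<Longrightarrow> p j \<in> D"
      "\<And>j i. j \<in> J \<Longrightarrow> i \<le> n \<Longrightarrow> h i (p j) = \<eta> * real (j i) / real N"
    by metis
  \<comment> \<open>Grid points attained in the same cell differ by less than one grid step in each
    coordinate, hence coincide.\<close>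
  have "inj_on (\<lambda>j. cell M (p j)) J"
  proof (rule inj_onI)
    fix j j' assume J: "j \<in> J" "j' \<in> J" "cell M (p j) = cell M (p j')"
    show "j = j'"
    proof (rule PiE_ext)
      show "j \<in> PiE {..n} (\<lambda>_. {..<N})" "j' \<in> PiE {..n} (\<lambda>_. {..<N})"
        using J by (auto simp: J_def)
      fix i assume "i \<in> {..n}"
      then have "\<bar>\<eta> * real (j i) / real N - \<eta> * real (j' i) / real N\<bar> \<le> b / real M"
        using diam[OF \<open>0 < M\<close> p(1)[OF J(1)] p(1)[OF J(2)] J(3), of i] p(2) J by simp
      also have "\<dots> = (b / real q) / real N"
        by (simp add: M_def)
      also have "\<eta> * real (j i) / real N - \<eta> * real (j' i) / real N
          = (\<eta> * (real (j i) - real (j' i))) / real N"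
        by (simp add: diff_divide_distrib right_diff_distrib)
      also have "\<bar>(\<eta> * (real (j i) - real (j' i))) / real N\<bar>
          = \<eta> * \<bar>real (j i) - real (j' i)\<bar> / real N"
        using \<open>0 < \<eta>\<close> by (simp add: abs_mult)
      finally have "\<eta> * \<bar>real (j i) - real (j' i)\<bar> \<le> b / real q"
        using \<open>0 < N\<close> unfolding divide_le_cancel by simp
      also have "\<dots> < \<eta>"
        using q \<open>0 < q\<close> \<open>0 < \<eta>\<close> by (simp add: field_simps)
      finally have "\<bar>real (j i) - real (j' i)\<bar> < 1"
        using \<open>0 < \<eta>\<close> by simp
      then show "j i = j' i" by linarith
    qed
  qed
  then have "card J \<le> card (cell M ` D)"
    using p(1) fin[OF \<open>0 < M\<close>] by (intro card_inj_on_le[of "\<lambda>j. cell M (p j)"]) auto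
  also have "\<dots> \<le> a * (M + 1) ^ n"
    by (rule card) fact
  also have "\<dots> \<le> a * ((q + 1) * N) ^ n"
    using \<open>0 < N\<close> by (intro mult_left_mono power_mono) (auto simp: M_def)
  also have "\<dots> = (a * (q + 1) ^ n) * N ^ n"
    by (simp only: power_mult_distrib mult.assoc)
  also have "\<dots> < N * N ^ n"
    using \<open>0 < N\<close> by (intro mult_strict_right_mono) (auto simp: N_def)
  also have "\<dots> = card J"
    by (simp add: J_def card_PiE)
  finally show False by simp
qed

text \<open>Geometrically, the boundary of the simplex \<open>V\<close> without the open facet opposite to \<open>v\<^sub>0\<close>,
  a cone with apex \<open>v\<^sub>0\<close>.\<close>

definition boundary_cone :: "'v set \<Rightarrow> 'v \<Rightarrow> ('v \<Rightarrow> real) set" where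
  "boundary_cone V v\<^sub>0 = {t. (\<forall>v. 0 \<le> t v) \<and> (\<forall>v. v \<notin> V \<longrightarrow> t v = 0) \<and> sum t V = 1 \<and>
     (\<exists>u\<in>V - {v\<^sub>0}. t u = 0)}"

lemma boundary_cone_unit_box:
  assumes "finite V" shows "boundary_cone V v\<^sub>0 \<subseteq> unit_box V"
proof
  fix t assume t: "t \<in> boundary_cone V v\<^sub>0"
  have "t v \<le> sum t V" if "v \<in> V" for v
    using assms that t by (intro member_le_sum) (auto simp: boundary_cone_def)
  then show "t \<in> unit_box V"
    using t by (auto simp: boundary_cone_def unit_box_def)
qed

text \<open>A cell records a facet containing \<open>t\<close>, chosen by a vanishing coordinate
  \<open>u\<close>, and the rounded coordinates other than \<open>u\<close> and
  \<open>v\<^sub>0\<close>. The coordinate at \<open>v\<^sub>0\<close> is determined by the sum, so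
  only \<open>n\<close> coordinates are rounded.\<close>

definition cone_cell :: "'v set \<Rightarrow> 'v \<Rightarrow> nat \<Rightarrow> ('v \<Rightarrow> real) \<Rightarrow> 'v \<times> ('v \<Rightarrow> nat)" where
  "cone_cell V v\<^sub>0 M t =
     (let u = SOME u. u \<in> V - {v\<^sub>0} \<and> t u = 0 in (u, \<lambda>v\<in>V - {u, v\<^sub>0}. nat \<lfloor>real M * t v\<rfloor>))"

lemma cone_cellE:
  assumes "t \<in> boundary_cone V v\<^sub>0"
  obtains u where "u \<in> V - {v\<^sub>0}" "t u = 0"
    "cone_cell V v\<^sub>0 M t = (u, \<lambda>v\<in>V - {u, v\<^sub>0}. nat \<lfloor>real M * t v\<rfloor>)"
proof -
  have "\<exists>u. u \<in> V - {v\<^sub>0} \<and> t u = 0"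
    using assms by (auto simp: boundary_cone_def)
  from someI_ex[OF this] show ?thesis
    by (intro that) (auto simp: cone_cell_def Let_def)
qed

text \<open>There are \<open>n + 1\<close> choices of \<open>u\<close>, and each of the
  \<open>n\<close> rounded coordinates takes values from 0 to \<open>M\<close> inclusive, as a
  coordinate may equal 1.\<close>

lemma card_cone_cells:
  assumes "finite V" "v\<^sub>0 \<in> V" "card V = n + 2"
  shows "finite (cone_cell V v\<^sub>0 M ` boundary_cone V v\<^sub>0)"
    "card (cone_cell V v\<^sub>0 M ` boundary_cone V v\<^sub>0) \<le> (n + 1) * (M + 1) ^ n"
proof -
  let ?T = "SIGMA u:V - {v\<^sub>0}. PiE (V - {u, v\<^sub>0}) (\<lambda>_. {..M})"
  have sub: "cone_cell V v\<^sub>0 M ` boundary_cone V v\<^sub>0 \<subseteq> ?T"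
  proof (rule image_subsetI)
    fix t assume t: "t \<in> boundary_cone V v\<^sub>0"
    then obtain u where u: "u \<in> V - {v\<^sub>0}" "t u = 0"
      "cone_cell V v\<^sub>0 M t = (u, \<lambda>v\<in>V - {u, v\<^sub>0}. nat \<lfloor>real M * t v\<rfloor>)"
      by (rule cone_cellE)
    have "nat \<lfloor>real M * t v\<rfloor> \<le> M" if "v \<in> V" for v
    proof -
      have "t v \<le> 1"
        using boundary_cone_unit_box[OF assms(1)] t that by (auto simp: unit_box_def)
      then have "real M * t v \<le> real M"
        by (simp add: mult_left_le)
      then show ?thesis by linarith
    qed
    then show "cone_cell V v\<^sub>0 M t \<in> ?T"
      unfolding u(3) using u(1) by auto
  qed
  have fin: "finite ?T"
    using assms(1) by (intro finite_SigmaI finite_PiE) auto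
  show "finite (cone_cell V v\<^sub>0 M ` boundary_cone V v\<^sub>0)"
    using sub fin by (rule finite_subset)
  have "card ?T = (\<Sum>u\<in>V - {v\<^sub>0}. card (PiE (V - {u, v\<^sub>0}) (\<lambda>_. {..M})))"
    using assms(1) by (intro card_SigmaI) (auto intro: finite_PiE)
  also have "\<dots> = (\<Sum>u\<in>V - {v\<^sub>0}. (M + 1) ^ n)"
  proof (rule sum.cong)
    fix u assume "u \<in> V - {v\<^sub>0}"
    then have "card (V - {u, v\<^sub>0}) = n"
      using assms by (subst card_Diff_subset) auto
    then show "card (PiE (V - {u, v\<^sub>0}) (\<lambda>_. {..M})) = (M + 1) ^ n"
      using assms(1) by (simp add: card_PiE)
  qed simp
  also have "\<dots> = (n + 1) * (M + 1) ^ n"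
    using assms by simp
  finally show "card (cone_cell V v\<^sub>0 M ` boundary_cone V v\<^sub>0) \<le> (n + 1) * (M + 1) ^ n"
    using card_mono[OF fin sub] by simp
qed

text \<open>Each of the \<open>n + 1\<close> coordinates other than \<open>v\<^sub>0\<close> changes
  by at most \<open>1 / M\<close>. As both sums are 1, the change at \<open>v\<^sub>0\<close> is at
  most the total of these changes, which gives the factor 2.\<close>

lemma cone_cell_diameter:
  assumes V: "finite V" "v\<^sub>0 \<in> V" "card V = n + 2" and "0 < M"
    and s: "s \<in> boundary_cone V v\<^sub>0" and t: "t \<in> boundary_cone V v\<^sub>0"
    and eq: "cone_cell V v\<^sub>0 M s = cone_cell V v\<^sub>0 M t"
  shows "l1_dist V s t \<le> 2 * (real n + 1) / real M"
proof -
  obtain u where u: "u \<in> V - {v\<^sub>0}" "s u = 0"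
    "cone_cell V v\<^sub>0 M s = (u, \<lambda>v\<in>V - {u, v\<^sub>0}. nat \<lfloor>real M * s v\<rfloor>)"
    using s by (rule cone_cellE)
  obtain u' where u': "u' \<in> V - {v\<^sub>0}" "t u' = 0"
    "cone_cell V v\<^sub>0 M t = (u', \<lambda>v\<in>V - {u', v\<^sub>0}. nat \<lfloor>real M * t v\<rfloor>)"
    using t by (rule cone_cellE)
  have "u' = u" and *: "(\<lambda>v\<in>V - {u, v\<^sub>0}. nat \<lfloor>real M * s v\<rfloor>) = (\<lambda>v\<in>V - {u, v\<^sub>0}. nat \<lfloor>real M * t v\<rfloor>)"
    using eq u(3) u'(3) by auto
  have le: "\<bar>s v - t v\<bar> \<le> 1 / M" if "v \<in> V - {v\<^sub>0}" for v
  proof (cases "v = u")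
    case True
    then show ?thesis using u u' \<open>u' = u\<close> by simp
  next
    case False
    then have "nat \<lfloor>real M * s v\<rfloor> = nat \<lfloor>real M * t v\<rfloor>"
      using fun_cong[OF *, of v] that by simp
    moreover have "0 \<le> real M * s v" "0 \<le> real M * t v"
      using s t by (auto simp: boundary_cone_def)
    ultimately have "\<bar>real M * s v - real M * t v\<bar> \<le> 1"
      by linarith
    then have "real M * \<bar>s v - t v\<bar> \<le> 1"
      by (simp add: abs_mult flip: right_diff_distrib)
    then show ?thesis
      using \<open>0 < M\<close> by (simp add: field_simps)
  qed
  have sum1: "s v\<^sub>0 = 1 - sum s (V - {v\<^sub>0})" "t v\<^sub>0 = 1 - sum t (V - {v\<^sub>0})"
    using s t V by (auto simp: boundary_cone_def sum_diff1)
  have "l1_dist V s t = \<bar>s v\<^sub>0 - t v\<^sub>0\<bar> + (\<Sum>v\<in>V - {v\<^sub>0}. \<bar>s v - t v\<bar>)"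
    unfolding l1_dist_def using V by (intro sum.remove) auto
  also have "\<bar>s v\<^sub>0 - t v\<^sub>0\<bar> = \<bar>\<Sum>v\<in>V - {v\<^sub>0}. s v - t v\<bar>"
    unfolding sum1 sum_subtractf by linarith
  also have "\<dots> \<le> (\<Sum>v\<in>V - {v\<^sub>0}. \<bar>s v - t v\<bar>)"
    by (rule sum_abs)
  finally have "l1_dist V s t \<le> 2 * (\<Sum>v\<in>V - {v\<^sub>0}. \<bar>s v - t v\<bar>)"
    by simp
  also have "(\<Sum>v\<in>V - {v\<^sub>0}. \<bar>s v - t v\<bar>) \<le> card (V - {v\<^sub>0}) * (1 / M)"
    using le by (intro sum_bounded_above) auto
  finally show ?thesis
    using V by (simp add: field_simps)
qed

text \<open>The sum \<open>B\<close> of the Lipschitz constants serves all coordinates, so the cells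
  of the cone satisfy the hypotheses of the grid count.\<close>

lemma lipschitz_map_misses_point:
  assumes V: "finite V" "v\<^sub>0 \<in> V" "card V = n + 2"
    and h: "\<And>i. i \<le> n \<Longrightarrow> h i \<in> lipschitz_maps V" and "0 < \<eta>"
  shows "\<exists>c. (\<forall>i\<le>n. \<bar>c i\<bar> \<le> \<eta>) \<and> (\<forall>t\<in>boundary_cone V v\<^sub>0. \<exists>i\<le>n. h i t \<noteq> c i)"
proof -
  have "\<exists>L\<ge>0. \<forall>s\<in>unit_box V. \<forall>t\<in>unit_box V. \<bar>h i s - h i t\<bar> \<le> L * l1_dist V s t" if "i \<le> n" for i
    using h[OF that] unfolding lipschitz_maps_def by blast
  then obtain L where L: "\<And>i. i \<le> n \<Longrightarrow> 0 \<le> L i"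
    "\<And>i s t. i \<le> n \<Longrightarrow> s \<in> unit_box V \<Longrightarrow> t \<in> unit_box V \<Longrightarrow> \<bar>h i s - h i t\<bar> \<le> L i * l1_dist V s t"
    by metis
  define B where "B = (\<Sum>i\<le>n. L i)"
  have B: "L i \<le> B" "0 \<le> B" if "i \<le> n" for i
    using L(1) that unfolding B_def by (auto intro!: member_le_sum sum_nonneg)
  show ?thesis
  proof (rule grid_point_not_attained[where cell = "cone_cell V v\<^sub>0" and a = "n + 1"
        and b = "B * (2 * (real n + 1))"])
    fix M :: nat and p q i assume M: "0 < M" and pq: "p \<in> boundary_cone V v\<^sub>0"
      "q \<in> boundary_cone V v\<^sub>0" "cone_cell V v\<^sub>0 M p = cone_cell V v\<^sub>0 M q" and i: "i \<le> n"
    have "\<bar>h i p - h i q\<bar> \<le> L i * l1_dist V p q"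
      using L(2)[OF i] pq boundary_cone_unit_box[OF V(1)] by blast
    also have "\<dots> \<le> B * (2 * (real n + 1) / real M)"
      using cone_cell_diameter[OF V M pq] B[OF i] l1_dist_nonneg by (intro mult_mono)
    finally show "\<bar>h i p - h i q\<bar> \<le> B * (2 * (real n + 1)) / real M"
      by simp
  qed (use card_cone_cells[OF V] \<open>0 < \<eta>\<close> in auto)
qed

text \<open>Two homotopies are joined: segments from \<open>f\<close> to a nowhere vanishing map
  \<open>w\<close> defined on the cone, then the contraction of the cone to its apex, both followed
  by radial projection.\<close>

lemma nullhomotopic_into_sphere:
  fixes V :: "'v set"
  assumes V: "finite V" "v\<^sub>0 \<in> V" "card V = n + 2"
    and S: "compact S" "S \<subseteq> boundary_cone V v\<^sub>0"
    and f: "continuous_on S f" "f ` S \<subseteq> unit_sphere n"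
  obtains a where "homotopic_with_canon (\<lambda>_. True) S (unit_sphere n) f (\<lambda>_. a)"
proof -
  \<comment> \<open>\<open>f\<close> and \<open>w\<close> will differ by at most
    \<open>2 * \<epsilon>\<close> in each of the \<open>n + 1\<close> coordinates, and this value
    makes \<open>(n + 1) * (2 * \<epsilon>)^2\<close> equal to \<open>\<epsilon>\<close>, which is
    less than 1.\<close>
  define \<epsilon> where "\<epsilon> = 1 / (4 * (real n + 1))"
  have "0 < \<epsilon>" by (simp add: \<epsilon>_def)
  have box: "boundary_cone V v\<^sub>0 \<subseteq> unit_box V"
    by (rule boundary_cone_unit_box[OF V(1)])
  have "\<exists>h\<in>lipschitz_maps V. \<forall>t\<in>S. \<bar>f t i - h t\<bar> < \<epsilon>" for i
  proof -
    have "t v = 0" if "t \<in> S" "v \<notin> V" for t v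
      using that S by (auto simp: boundary_cone_def)
    then obtain h where "h \<in> lipschitz_maps V" "\<And>t. t \<in> S \<Longrightarrow> \<bar>f t i - h t\<bar> < \<epsilon>"
      using lipschitz_approximation[OF V(1) S(1) order_trans[OF S(2) box] _
          continuous_on_product_then_coordinatewise[OF f(1)] \<open>0 < \<epsilon>\<close>] by metis
    then show ?thesis by blast
  qed
  then obtain h where h: "\<And>i. h i \<in> lipschitz_maps V" "\<And>i t. t \<in> S \<Longrightarrow> \<bar>f t i - h i t\<bar> < \<epsilon>"
    by metis
  obtain c where c: "\<And>i. i \<le> n \<Longrightarrow> \<bar>c i\<bar> \<le> \<epsilon>" "\<And>t. t \<in> boundary_cone V v\<^sub>0 \<Longrightarrow> \<exists>i\<le>n. h i t \<noteq> c i"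
    using lipschitz_map_misses_point[OF V, of h \<epsilon>] h(1) \<open>0 < \<epsilon>\<close> by metis
  define w where "w t i = (if i \<le> n then h i t - c i else 0)" for t i
  have cont_w: "continuous_on UNIV w"
  proof (rule continuous_on_coordinatewise_then_product)
    show "continuous_on UNIV (\<lambda>t. w t i)" for i
      using h(1)[of i] unfolding w_def
      by (cases "i \<le> n") (auto simp: lipschitz_maps_def intro!: continuous_on_diff)
  qed
  have w: "(\<Sum>i\<le>n. (w t i)\<^sup>2) \<noteq> 0" if t: "t \<in> boundary_cone V v\<^sub>0" for t
  proof -
    obtain i where "i \<le> n" "h i t \<noteq> c i" using c(2)[OF t] by blast
    then have "0 < (w t i)\<^sup>2" "(w t i)\<^sup>2 \<le> (\<Sum>i\<le>n. (w t i)\<^sup>2)"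
      by (auto simp: w_def intro!: member_le_sum)
    then show ?thesis by linarith
  qed
  define H where "H z = (\<lambda>i. (1 - fst z) * f (snd z) i + fst z * w (snd z) i)" for z
  have H: "(\<Sum>i\<le>n. (H (u, t) i)\<^sup>2) \<noteq> 0" if u: "u \<in> {0..1}" and t: "t \<in> S" for u t
  proof
    assume "(\<Sum>i\<le>n. (H (u, t) i)\<^sup>2) = 0"
    then have "\<forall>i\<in>{..n}. (H (u, t) i)\<^sup>2 = 0"
      by (subst (asm) sum_nonneg_eq_0_iff) auto
    \<comment> \<open>At a zero of the segment, \<open>f\<close> is \<open>u\<close> times the error
      \<open>f - w\<close> with \<open>u\<close> at most 1, so the unit vector \<open>f t\<close>
      would be as small as the error.\<close>
    then have *: "f t i = u * (f t i - w t i)" if "i \<le> n" for i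
      using that by (simp add: H_def algebra_simps)
    have "(f t i)\<^sup>2 \<le> (2 * \<epsilon>)\<^sup>2" if "i \<le> n" for i
    proof -
      have "\<bar>f t i - w t i\<bar> \<le> 2 * \<epsilon>"
        using h(2)[OF t, of i] c(1)[OF that] that by (simp add: w_def)
      moreover have "\<bar>f t i\<bar> \<le> 1 * \<bar>f t i - w t i\<bar>"
        using u by (subst *[OF that]) (auto simp: abs_mult intro!: mult_left_le_one_le)
      ultimately have "\<bar>f t i\<bar> \<le> 2 * \<epsilon>" by simp
      then show ?thesis
        using abs_le_square_iff[of "f t i" "2 * \<epsilon>"] \<open>0 < \<epsilon>\<close> by simp
    qed
    then have "(\<Sum>i\<le>n. (f t i)\<^sup>2) \<le> (real n + 1) * (2 * \<epsilon>)\<^sup>2"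
      using sum_bounded_above[of "{..n}" "\<lambda>i. (f t i)\<^sup>2" "(2 * \<epsilon>)\<^sup>2"] by (simp add: add.commute)
    also have "\<dots> = \<epsilon>"
      by (simp add: \<epsilon>_def power2_eq_square divide_simps)
    also have "\<dots> < 1"
      by (simp add: \<epsilon>_def)
    finally show False
      using f(2) t by (auto simp: unit_sphere_def)
  qed
  have fz: "f t i = 0" if "t \<in> S" "n < i" for t i
    using f(2) that by (auto simp: unit_sphere_def)
  have cont_H: "continuous_on ({0..1} \<times> S) H"
  proof (rule continuous_on_coordinatewise_then_product)
    fix i
    have "continuous_on ({0..1} \<times> S) (\<lambda>z. f (snd z) i)"
      using continuous_on_product_then_coordinatewise[OF f(1)]
      by (rule continuous_on_compose2) (auto intro: continuous_on_snd continuous_on_id)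
    moreover have "continuous_on ({0..1} \<times> S) (\<lambda>z. w (snd z) i)"
      using continuous_on_product_then_coordinatewise[OF cont_w]
      by (rule continuous_on_compose2) (auto intro: continuous_on_snd continuous_on_id)
    ultimately show "continuous_on ({0..1} \<times> S) (\<lambda>z. H z i)"
      unfolding H_def by (intro continuous_intros)
  qed
  have "homotopic_with_canon (\<lambda>_. True) S (unit_sphere n) f (\<lambda>t. normalize_upto n (w t))"
  proof (rule homotopic_with_canonI[where H = "\<lambda>z. normalize_upto n (H z)"])
    show "continuous_on ({0..1} \<times> S) (\<lambda>z. normalize_upto n (H z))"
      using H by (intro continuous_on_normalize_upto cont_H) auto
    show "normalize_upto n (H (u, t)) \<in> unit_sphere n" if "u \<in> {0..1}" "t \<in> S" for u t
      using that H by (intro normalize_upto_in) (auto simp: H_def fz w_def)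
    show "normalize_upto n (H (0, t)) = f t" if "t \<in> S" for t
      using normalize_upto_scale[of "f t" n 1] f(2) that by (auto simp: H_def)
    show "normalize_upto n (H (1, t)) = normalize_upto n (w t)" for t
      by (simp add: H_def)
  qed
  moreover
  \<comment> \<open>The apex of the cone. A coordinate other than \<open>v\<^sub>0\<close> that
    vanishes at \<open>t\<close> vanishes at \<open>e\<close> too, so segments to \<open>e\<close>
    stay in the cone.\<close>
  define e where "e = (\<lambda>v. if v = v\<^sub>0 then 1 else 0 :: real)"
  define G where "G z = (\<lambda>v. (1 - fst z) * snd z v + fst z * e v)" for z :: "real \<times> ('v \<Rightarrow> real)"
  have G: "G (u, t) \<in> boundary_cone V v\<^sub>0" if "u \<in> {0..1}" "t \<in> boundary_cone V v\<^sub>0" for u t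
  proof -
    have "sum e V = 1" using V by (simp add: e_def)
    then have "(\<Sum>v\<in>V. (1 - u) * t v + u * e v) = 1"
      using that by (simp add: sum.distrib boundary_cone_def flip: sum_distrib_left)
    then show ?thesis
      using that V(2) by (auto simp: G_def e_def boundary_cone_def)
  qed
  have cont_G: "continuous_on ({0..1} \<times> S) (\<lambda>z. w (G z))"
  proof (rule continuous_on_compose2[OF cont_w])
    show "continuous_on ({0..1} \<times> S) G"
      unfolding G_def
      by (intro continuous_on_coordinatewise_then_product continuous_on_add continuous_on_mult
          continuous_on_diff continuous_on_const continuous_on_fst continuous_on_id
          continuous_on_product_then_coordinatewise[OF continuous_on_snd[OF continuous_on_id]])
  qed auto
  have "homotopic_with_canon (\<lambda>_. True) S (unit_sphere n) (\<lambda>t. normalize_upto n (w t))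
      (\<lambda>_. normalize_upto n (w e))"
  proof (rule homotopic_with_canonI[where H = "\<lambda>z. normalize_upto n (w (G z))"])
    show "continuous_on ({0..1} \<times> S) (\<lambda>z. normalize_upto n (w (G z)))"
      using w G S(2) by (intro continuous_on_normalize_upto cont_G) auto
    show "normalize_upto n (w (G (u, t))) \<in> unit_sphere n" if "u \<in> {0..1}" "t \<in> S" for u t
      using that w G S(2) by (intro normalize_upto_in) (auto simp: w_def)
  qed (simp_all add: G_def)
  ultimately show ?thesis
    using that homotopic_with_trans by blast
qed

theorem proper_subcomplex_not_homotopy_sphere:
  assumes V: "finite V" "card V = n + 2"
    and K: "K \<subset> boundary_complex V" and down: "\<And>\<sigma> \<tau>. \<sigma> \<in> K \<Longrightarrow> \<tau> \<subseteq> \<sigma> \<Longrightarrow> \<tau> \<in> K"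
  shows "\<not> geometric_realization K homotopy_equivalent_space nsphere n"
proof
  assume "geometric_realization K homotopy_equivalent_space nsphere n"
  then obtain f g where
    f: "continuous_map (top_of_set (realization K)) (top_of_set (unit_sphere n)) f" and
    g: "continuous_map (top_of_set (unit_sphere n)) (top_of_set (realization K)) g" and
    fg: "homotopic_with_canon (\<lambda>_. True) (unit_sphere n) (unit_sphere n) (f \<circ> g) id"
    unfolding homotopy_equivalent_space_def geometric_realization_eq nsphere_eq by blast
  \<comment> \<open>No support of a point of the realization contains the missing face
    \<open>W\<close>, so some coordinate in \<open>W\<close> vanishes, and it is not the one at
    \<open>v\<^sub>0\<close>.\<close>
  obtain W v\<^sub>0 where W: "W \<subset> V" "W \<notin> K" "v\<^sub>0 \<in> V" "v\<^sub>0 \<notin> W"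
    using K unfolding boundary_complex_def by blast
  have KV: "K \<subseteq> Pow V"
    using K by (auto simp: boundary_complex_def)
  have sub: "realization K \<subseteq> boundary_cone V v\<^sub>0"
  proof
    fix t assume "t \<in> realization K"
    then have t: "\<forall>v. 0 \<le> t v" "{v. t v \<noteq> 0} \<in> K" "sum t V = 1"
      using realization_iff[OF V(1) KV] by auto
    have "\<not> W \<subseteq> {v. t v \<noteq> 0}"
      using down[OF t(2)] W(2) by blast
    then obtain u where "u \<in> W" "t u = 0" by blast
    with W t KV show "t \<in> boundary_cone V v\<^sub>0"
      unfolding boundary_cone_def by blast
  qed
  have "compact (realization K)"
    using V(1) KV down by (rule compact_realization)
  moreover have "continuous_on (realization K) f" "f ` realization K \<subseteq> unit_sphere n"
    using f by auto
  ultimately obtain a where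
    "homotopic_with_canon (\<lambda>_. True) (realization K) (unit_sphere n) f (\<lambda>_. a)"
    using nullhomotopic_into_sphere[OF V(1) W(3) V(2) _ sub] by metis
  then have "homotopic_with_canon (\<lambda>_. True) (unit_sphere n) (unit_sphere n) (f \<circ> g) ((\<lambda>_. a) \<circ> g)"
    using g by (rule homotopic_with_compose_continuous_map_right) simp
  then have "homotopic_with_canon (\<lambda>_. True) (unit_sphere n) (unit_sphere n) id (\<lambda>_. a)"
    using homotopic_with_trans[OF homotopic_with_symD[OF fg]] by (simp add: comp_def)
  then show False
    using non_contractible_space_nsphere[of n] unfolding contractible_space_def nsphere_eq by blast
qed

section \<open>Privacy and links\<close>

locale identifiable =
  fixes X :: "'a set" and Y :: "'b set" and R :: "('a \<times> 'b) set" and x :: 'a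
  assumes finX: "finite X" and finY: "finite Y" and R: "R \<subseteq> X \<times> Y"
    and card_X: "card X > 1" and x: "x \<in> X" and ident: "uniquely_identifiable X Y R x"
begin

abbreviation "Yx \<equiv> attributes_of Y R x"
abbreviation "Xbar \<equiv> link_individuals X Y R {x}"
abbreviation "Q \<equiv> link_relation X Y R {x}"

lemma Yx_iff: "y \<in> Yx \<longleftrightarrow> (x, y) \<in> R"
  using R by (auto simp: attributes_of_def)

lemma link_attributes_eq: "link_attributes Y R {x} = Yx"
  by (auto simp: link_attributes_def phi_def attributes_of_def)

lemma Xbar_iff: "z \<in> Xbar \<longleftrightarrow> z \<noteq> x \<and> (\<exists>y\<in>Yx. (z, y) \<in> R)"
  using R by (auto simp: link_individuals_def link_attributes_eq individuals_of_def)

lemma Q_iff: "(z, y) \<in> Q \<longleftrightarrow> z \<noteq> x \<and> y \<in> Yx \<and> (z, y) \<in> R"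
  by (auto simp: link_relation_def link_attributes_eq Xbar_iff)

lemma finite_Yx: "finite Yx"
  using finY by (simp add: attributes_of_def)

lemma finite_Xbar: "finite Xbar"
  using finX by (rule finite_subset[rotated]) (use R in \<open>auto simp: Xbar_iff\<close>)

lemma identD:
  assumes "z \<in> X" "\<And>y. y \<in> Yx \<Longrightarrow> (z, y) \<in> R"
  shows "z = x"
proof -
  have "z \<in> psi X R Yx"
    using assms by (auto simp: psi_def individuals_of_def)
  then show ?thesis
    using ident by (simp add: uniquely_identifiable_def)
qed

lemma other_individual: obtains z where "z \<in> X" "z \<noteq> x"
  using card_X card_le_Suc0_iff_eq[OF finX] x by (metis One_nat_def not_le)

text \<open>Without attributes of \<open>x\<close>, every individual would share all of them
  vacuously, so identifiability would leave \<open>x\<close> as the only individual.\<close>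

lemma Yx_nonempty: "Yx \<noteq> {}"
proof
  assume "Yx = {}"
  then have "z = x" if "z \<in> X" for z
    using identD that by blast
  then show False
    using other_individual by blast
qed

text \<open>An attribute common to \<open>\<tau>\<close> and \<open>x\<close> is an attribute of
  \<open>x\<close>, so one witness serves both complexes.\<close>

lemma link_complex_eq: "link_complex (dowker_Psi X Y R) {x} = dowker_Psi Xbar Yx Q"
proof (intro equalityI subsetI)
  fix \<tau> assume "\<tau> \<in> link_complex (dowker_Psi X Y R) {x}"
  then obtain y where y: "y \<in> Y" "\<forall>z\<in>\<tau> \<union> {x}. (z, y) \<in> R" "\<tau> \<subseteq> X" "x \<notin> \<tau>"
    by (auto simp: link_complex_def dowker_Psi_def)
  then have "y \<in> Yx" by (simp add: Yx_iff)
  with y show "\<tau> \<in> dowker_Psi Xbar Yx Q"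
    unfolding dowker_Psi_def by (auto simp: Xbar_iff Q_iff intro!: bexI[of _ y])
next
  fix \<tau> assume "\<tau> \<in> dowker_Psi Xbar Yx Q"
  then obtain y where "y \<in> Yx" "\<forall>z\<in>\<tau>. z \<noteq> x \<and> (z, y) \<in> R"
    unfolding dowker_Psi_def by (auto simp: Q_iff)
  then show "\<tau> \<in> link_complex (dowker_Psi X Y R) {x}"
    using R x unfolding link_complex_def dowker_Psi_def by (auto simp: Yx_iff)
qed

text \<open>If \<open>Yx\<close> itself were a simplex, some individual other than \<open>x\<close>
  would have all attributes of \<open>x\<close>.\<close>

lemma Phi_subset_boundary: "dowker_Phi Xbar Yx Q \<subseteq> boundary_complex Yx"
proof
  fix \<gamma> assume \<gamma>: "\<gamma> \<in> dowker_Phi Xbar Yx Q"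
  then have "\<gamma> \<subseteq> Yx"
    by (auto simp: dowker_Phi_def split: if_splits)
  moreover have "\<gamma> \<noteq> Yx"
  proof
    assume "\<gamma> = Yx"
    then obtain z where "z \<in> Xbar" "\<forall>y\<in>Yx. (z, y) \<in> Q"
      using \<gamma> Yx_nonempty by (auto simp: dowker_Phi_def split: if_splits)
    then have "z \<noteq> x" "\<forall>y\<in>Yx. (z, y) \<in> R"
      by (auto simp: Q_iff Xbar_iff)
    moreover from this have "z \<in> X"
      using Yx_nonempty R by blast
    ultimately show False
      using identD by blast
  qed
  ultimately show "\<gamma> \<in> boundary_complex Yx"
    by (auto simp: boundary_complex_def)
qed

lemma Phi_mono: "\<sigma> \<in> dowker_Phi Xbar Yx Q \<Longrightarrow> \<tau> \<subseteq> \<sigma> \<Longrightarrow> \<tau> \<in> dowker_Phi Xbar Yx Q"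
  unfolding dowker_Phi_def by (auto split: if_splits)

text \<open>This is the sphere of dimension -1, where complexes are compared literally. Anyone else
  with the only attribute of \<open>x\<close> would violate identifiability, so \<open>Xbar\<close>
  is empty and both complexes are \<open>{{}}\<close>.\<close>

lemma singleton_case:
  assumes "card Yx = 1"
  shows "link_complex (dowker_Psi X Y R) {x} = {{}}"
    and "dowker_Phi Xbar Yx Q = boundary_complex Yx"
proof -
  obtain y where y: "Yx = {y}"
    using assms card_1_singletonE by blast
  have "z \<notin> Xbar" for z
  proof
    assume "z \<in> Xbar"
    then have "z \<noteq> x" "(z, y) \<in> R"
      using y by (auto simp: Xbar_iff)
    moreover from this have "z \<in> X"
      using R by blast
    ultimately show False
      using identD[of z] y by simp
  qed
  then have "Xbar = {}"
    by blast
  then show "link_complex (dowker_Psi X Y R) {x} = {{}}"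
    "dowker_Phi Xbar Yx Q = boundary_complex Yx"
    unfolding link_complex_eq using y by (auto simp: dowker_Psi_def dowker_Phi_def boundary_complex_def)
qed

theorem link_sphere_iff:
  "homotopy_equivalent_to_sphere (link_complex (dowker_Psi X Y R) {x}) (int (card Yx) - 2)
    \<longleftrightarrow> dowker_Phi Xbar Yx Q = boundary_complex Yx"
proof (cases "card Yx = 1")
  case True
  then show ?thesis
    using singleton_case by (simp add: homotopy_equivalent_to_sphere_def)
next
  case False
  moreover have "card Yx \<noteq> 0"
    using finite_Yx Yx_nonempty by simp
  \<comment> \<open>The subtraction of naturals is exact, since 0 and 1 are excluded.\<close>
  ultimately have "card Yx = (card Yx - 2) + 2"
    by linarith
  then obtain n where n: "card Yx = n + 2"
    by blast
  have "homotopy_equivalent_to_sphere (link_complex (dowker_Psi X Y R) {x}) (int (card Yx) - 2)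
      \<longleftrightarrow> geometric_realization (dowker_Psi Xbar Yx Q) homotopy_equivalent_space nsphere n"
    by (simp add: n homotopy_equivalent_to_sphere_def link_complex_eq)
  also have "\<dots> \<longleftrightarrow> geometric_realization (dowker_Phi Xbar Yx Q) homotopy_equivalent_space nsphere n"
    using dowker_duality[OF finite_Xbar finite_Yx, of Q]
    by (meson homotopy_eqv_trans homotopy_equivalent_space_sym)
  also have "\<dots> \<longleftrightarrow> dowker_Phi Xbar Yx Q = boundary_complex Yx"
  proof
    assume *: "geometric_realization (dowker_Phi Xbar Yx Q) homotopy_equivalent_space nsphere n"
    show "dowker_Phi Xbar Yx Q = boundary_complex Yx"
    proof (rule ccontr)
      assume "dowker_Phi Xbar Yx Q \<noteq> boundary_complex Yx"
      then have "dowker_Phi Xbar Yx Q \<subset> boundary_complex Yx"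
        using Phi_subset_boundary by (rule psubsetI[rotated])
      from proper_subcomplex_not_homotopy_sphere[OF finite_Yx n this Phi_mono] * show False
        by (rule notE)
    qed
  next
    assume eq: "dowker_Phi Xbar Yx Q = boundary_complex Yx"
    show "geometric_realization (dowker_Phi Xbar Yx Q) homotopy_equivalent_space nsphere n"
      unfolding eq using homeomorphic_boundary_nsphere[OF finite_Yx n]
      by (rule homeomorphic_imp_homotopy_equivalent_space)
  qed
  finally show ?thesis .
qed

lemma closure_iff:
  "y \<in> (phi Y R \<circ> psi X R) \<gamma> \<longleftrightarrow> y \<in> Y \<and> (\<forall>z\<in>X. (\<forall>y'\<in>\<gamma>. (z, y') \<in> R) \<longrightarrow> (z, y) \<in> R)"
  by (auto simp: phi_def psi_def attributes_of_def individuals_of_def)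

text \<open>An attribute \<open>y\<close> of \<open>x\<close> is not implied by the others exactly
  when some individual has all attributes of \<open>x\<close> except \<open>y\<close>. Such an
  individual witnesses the facet \<open>Yx - {y}\<close>.\<close>

theorem privacy_iff:
  "preserves_attribute_privacy X Y R x \<longleftrightarrow> dowker_Phi Xbar Yx Q = boundary_complex Yx"
proof
  assume priv: "preserves_attribute_privacy X Y R x"
  have facet: "Yx - {y} \<in> dowker_Phi Xbar Yx Q" if y: "y \<in> Yx" for y
  proof (cases "Yx = {y}")
    case True
    then have "dowker_Phi Xbar Yx Q = boundary_complex Yx"
      using singleton_case(2) by simp
    then show ?thesis
      using y by (auto simp: boundary_complex_def)
  next
    case False
    have "y \<notin> (phi Y R \<circ> psi X R) (Yx - {y})"
      using priv unfolding preserves_attribute_privacy_def by blast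
    then obtain z where z: "z \<in> X" "\<forall>y'\<in>Yx - {y}. (z, y') \<in> R" "(z, y) \<notin> R"
      using y R unfolding closure_iff by (auto simp: attributes_of_def)
    then have "z \<noteq> x"
      using y by (auto simp: Yx_iff)
    \<comment> \<open>Since \<open>Yx\<close> is not \<open>{y}\<close>, there is another attribute
      of \<open>x\<close>, and \<open>z\<close> shares it.\<close>
    moreover have "z \<in> Xbar"
      using z False y \<open>z \<noteq> x\<close> unfolding Xbar_iff by blast
    ultimately show ?thesis
      using z unfolding dowker_Phi_def by (auto simp: Q_iff intro!: bexI[of _ z])
  qed
  have "boundary_complex Yx \<subseteq> dowker_Phi Xbar Yx Q"
  proof
    fix \<gamma> assume "\<gamma> \<in> boundary_complex Yx"
    then obtain y where "y \<in> Yx" "\<gamma> \<subseteq> Yx - {y}"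
      unfolding boundary_complex_def by blast
    then show "\<gamma> \<in> dowker_Phi Xbar Yx Q"
      using Phi_mono[OF facet] by blast
  qed
  then show "dowker_Phi Xbar Yx Q = boundary_complex Yx"
    using Phi_subset_boundary by blast
next
  assume eq: "dowker_Phi Xbar Yx Q = boundary_complex Yx"
  have notin: "y \<notin> (phi Y R \<circ> psi X R) \<gamma>" if \<gamma>: "\<gamma> \<subseteq> Yx" "y \<in> Yx" "y \<notin> \<gamma>" for \<gamma> y
  proof (cases "Xbar = {}")
    case True
    then have "boundary_complex Yx = {{}}"
      using Yx_nonempty by (simp add: dowker_Phi_def flip: eq)
    moreover have "Yx - {y} \<in> boundary_complex Yx"
      using \<gamma>(2) by (auto simp: boundary_complex_def)
    ultimately have "Yx - {y} = {}"
      by simp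
    then have "Yx = {y}"
      using \<gamma>(2) by blast
    then have "\<gamma> = {}"
      using \<gamma> by auto
    \<comment> \<open>With \<open>Xbar\<close> empty, no individual witnesses the facet, which is
      \<open>{}\<close>. Any individual other than \<open>x\<close> shows that \<open>y\<close> is
      not implied by the empty set.\<close>
    obtain z where z: "z \<in> X" "z \<noteq> x"
      by (rule other_individual)
    then have "(z, y) \<notin> R"
      using identD[OF z(1)] \<open>Yx = {y}\<close> by auto
    with z \<open>\<gamma> = {}\<close> show ?thesis
      unfolding closure_iff by blast
  next
    case False
    have "Yx - {y} \<in> dowker_Phi Xbar Yx Q"
      using \<gamma>(2) unfolding eq boundary_complex_def by blast
    then obtain z where "z \<in> Xbar" "\<forall>y'\<in>Yx - {y}. (z, y') \<in> Q"
      using False unfolding dowker_Phi_def by auto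
    then have z: "z \<in> X" "z \<noteq> x" "\<forall>y'\<in>Yx - {y}. (z, y') \<in> R"
      using R by (auto simp: Xbar_iff Q_iff)
    moreover have "(z, y) \<notin> R"
      using identD[OF z(1)] z by blast
    ultimately show ?thesis
      using \<gamma> unfolding closure_iff by blast
  qed
  show "preserves_attribute_privacy X Y R x"
    unfolding preserves_attribute_privacy_def
  proof (intro allI impI equalityI subsetI)
    fix \<gamma> y assume \<gamma>: "\<gamma> \<subseteq> Yx" and y: "y \<in> (phi Y R \<circ> psi X R) \<gamma>"
    have "\<forall>y'\<in>\<gamma>. (x, y') \<in> R"
      using \<gamma> by (auto simp: Yx_iff)
    then have "y \<in> Yx"
      using y x unfolding closure_iff Yx_iff by blast
    then show "y \<in> \<gamma>"
      using notin[OF \<gamma>] y by blast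
  next
    fix \<gamma> y assume "\<gamma> \<subseteq> Yx" "y \<in> \<gamma>"
    then show "y \<in> (phi Y R \<circ> psi X R) \<gamma>"
      unfolding closure_iff by (auto simp: attributes_of_def)
  qed
qed

end

theorem theorem10:
  fixes X :: "'a set" and Y :: "'b set" and R Q :: "('a \<times> 'b) set"
    and x :: 'a and k :: nat
  assumes "finite X" and "finite Y" and "R \<subseteq> X \<times> Y"
    and "card X > 1"
    and "x \<in> X"
    and "uniquely_identifiable X Y R x"
    and "Q = link_relation X Y R {x}"
    and "k = card (attributes_of Y R x)"
  shows "(preserves_attribute_privacy X Y R x \<longleftrightarrow>
            homotopy_equivalent_to_sphere (link_complex (dowker_Psi X Y R) {x}) (int k - 2))
       \<and> (homotopy_equivalent_to_sphere (link_complex (dowker_Psi X Y R) {x}) (int k - 2) \<longleftrightarrow>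
            dowker_Phi (link_individuals X Y R {x}) (link_attributes Y R {x}) Q
              = boundary_complex (attributes_of Y R x))"
proof -
  interpret identifiable X Y R x
    using assms by unfold_locales
  show ?thesis
    using link_sphere_iff privacy_iff assms(7,8) by (simp add: link_attributes_eq)
qed

end
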